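(* Let $(\Omega,\Sigma,\mu)$ be a finite, positive, non-atomic measure space with $\mu(\Omega)>0$, let $K$ be a compact Hausdorff space and $E$ a Banach space. Let $1\le q<p<\infty$ and $\sigma=1/p'$, where $1/p+1/p'=1$. A continuous linear operator $u:C(K)\to E$ is $(p,q)$-summing if and only if the composition operator $\tilde u(f)=u\circ f$ from $\mathcal P_p^\sigma(\mu,C(K))$ to $\mathcal B_p(\mu,E)$ is well defined and continuous.
   Context: $C(K)$ is the space of continuous functions on $K$ with the sup norm. A linear operator $T:X\to Y$ between Banach spaces is $(p,q)$-summing if there is $C>0$ with $(\sum_{i=1}^n\|T(x_i)\|^p)^{1/p}\le C\sup_{x'\in B_{X^*}}(\sum_{i=1}^n|\langle x_i,x'\rangle|^q)^{1/q}$ for all finite families $x_1,\dots,x_n\in X$. For $1\le p<\infty$ and a Banach space $X$, $\mathcal P_p(\mu,X)$ is the space of ($\mu$-a.e. classes of) strongly measurable Pettis $p$-integrable functions $f:\Omega\to X$ (Pettis integrable with $x'\circ f\in L^p(\mu)$ for all $x'\in X^*$) with norm $\|f\|_{\mathcal P_p}=\sup_{x'\in B_{X^*}}(\int|x'(f(w))|^p\,d\mu(w))^{1/p}$. $\mathcal B_p(\mu,X)$ is the space of Bochner $p$-integrable functions $f:\Omega\to X$ with norm $(\int\|f(w)\|^p\,d\mu(w))^{1/p}$. For $1\le p<\infty$, $0\le\sigma\le1$ let $\mathcal S_p^\sigma(\mu,X)$ be the space of $\mu$-classes of $X$-valued simple functions. For such $f$ put $$\Phi_{p,\sigma}(f)=\sup_{x'\in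 B_{X^*}}\Big(\int\big(|\langle f(w),x'\rangle|^{1-\sigma}\|f(w)\|^\sigma\big)^p\,d\mu(w)\Big)^{1/p}$$ and $\|f\|_{p,\sigma}=\inf\{\sum_{i=1}^n\Phi_{p,\sigma}(f_i): f=\sum_{i=1}^n f_i,\ f_i\in\mathcal S_p^\sigma(\mu,X)\}$. This is a norm with $\|\cdot\|_{\mathcal P_p}\le\|\cdot\|_{p,\sigma}$. Define $\mathcal P_p^\sigma(\mu,X):=\overline{\mathcal S_p^\sigma(\mu,X)}\cap\mathcal P_p(\mu,X)$, where $\overline{\mathcal S_p^\sigma(\mu,X)}$ is the completion for $\|\cdot\|_{p,\sigma}$, with the norm induced by that completion; concretely, it consists of those $f\in\mathcal P_p(\mu,X)$ for which there is a $\|\cdot\|_{p,\sigma}$-Cauchy sequence $(f_n)$ of simple functions converging to $f$ in $\|\cdot\|_{\mathcal P_p}$, and the norm of $f$ is the infimum of $\lim_n\|f_n\|_{p,\sigma}$ over such sequences. "Well defined" means $u\circ f\in\mathcal B_p(\mu,E)$ for every $f$ in the domain. *)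

theory Defs
  imports "HOL-Analysis.Analysis"
begin

text \<open>The target spaces need not be second countable, so the Bochner integrability notions of
  the library do not apply. Elements of the function spaces below are represented by functions;
  all sets and (extended) norms are invariant under changes on null sets.\<close>

definition nonatomic :: "'w measure \<Rightarrow> bool" where
  "nonatomic M \<longleftrightarrow>
     (\<forall>A\<in>sets M. emeasure M A > 0 \<longrightarrow>
        (\<exists>B\<in>sets M. B \<subseteq> A \<and> 0 < emeasure M B \<and> emeasure M B < emeasure M A))"

definition strongly_measurable :: "'w measure \<Rightarrow> ('w \<Rightarrow> 'x::real_normed_vector) \<Rightarrow> bool" where
  "strongly_measurable M f \<longleftrightarrow>
     (\<exists>s. (\<forall>n. simple_function M (s n)) \<and> (AE w in M. (\<lambda>n. s n w) \<longlonglongrightarrow> f w))"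

definition Lp_norm :: "'w measure \<Rightarrow> real \<Rightarrow> ('w \<Rightarrow> real) \<Rightarrow> ennreal" where
  "Lp_norm M p g =
     (let I = (\<integral>\<^sup>+ w. ennreal (\<bar>g w\<bar> powr p) \<partial>M)
      in if I = \<infinity> then \<infinity> else ennreal (enn2real I powr (1 / p)))"

text \<open>An almost everywhere limit of simple functions is measurable only for the completion of
  the measure, hence the completion in the scalar integrals.\<close>

definition pettis_integrable :: "'w measure \<Rightarrow> ('w \<Rightarrow> 'x::real_normed_vector) \<Rightarrow> bool" where
  "pettis_integrable M f \<longleftrightarrow>
     (\<forall>x' :: 'x \<Rightarrow>\<^sub>L real. integrable (completion M) (\<lambda>w. blinfun_apply x' (f w))) \<and>
     (\<forall>A\<in>sets M. \<exists>x. \<forall>x' :: 'x \<Rightarrow>\<^sub>L real.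
        blinfun_apply x' x = set_lebesgue_integral (completion M) A (\<lambda>w. blinfun_apply x' (f w)))"

definition pettis_space :: "'w measure \<Rightarrow> real \<Rightarrow> ('w \<Rightarrow> 'x::real_normed_vector) set" where
  "pettis_space M p =
     {f. strongly_measurable M f \<and> pettis_integrable M f \<and>
         (\<forall>x' :: 'x \<Rightarrow>\<^sub>L real. Lp_norm M p (\<lambda>w. blinfun_apply x' (f w)) < \<infinity>)}"

definition pettis_norm :: "'w measure \<Rightarrow> real \<Rightarrow> ('w \<Rightarrow> 'x::real_normed_vector) \<Rightarrow> ennreal" where
  "pettis_norm M p f = (SUP x' \<in> cball (0 :: 'x \<Rightarrow>\<^sub>L real) 1. Lp_norm M p (\<lambda>w. blinfun_apply x' (f w)))"

definition bochner_norm :: "'w measure \<Rightarrow> real \<Rightarrow> ('w \<Rightarrow> 'x::real_normed_vector) \<Rightarrow> ennreal" where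
  "bochner_norm M p f = Lp_norm M p (\<lambda>w. norm (f w))"

definition bochner_space :: "'w measure \<Rightarrow> real \<Rightarrow> ('w \<Rightarrow> 'x::real_normed_vector) set" where
  "bochner_space M p = {f. strongly_measurable M f \<and> bochner_norm M p f < \<infinity>}"

text \<open>In HOL \<open>0 powr 0 = 0\<close>. This matters in \<open>Phi\<close> only for \<open>\<sigma> = 1\<close>, and even then not for the
  supremum when \<open>f\<close> is simple: some functional in the dual ball vanishes at none of the finitely
  many nonzero values of \<open>f\<close>.\<close>

definition Phi :: "'w measure \<Rightarrow> real \<Rightarrow> real \<Rightarrow> ('w \<Rightarrow> 'x::real_normed_vector) \<Rightarrow> ennreal" where
  "Phi M p \<sigma> f =
     (SUP x' \<in> cball (0 :: 'x \<Rightarrow>\<^sub>L real) 1.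
        Lp_norm M p (\<lambda>w. \<bar>blinfun_apply x' (f w)\<bar> powr (1 - \<sigma>) * norm (f w) powr \<sigma>))"

definition simple_norm ::
  "'w measure \<Rightarrow> real \<Rightarrow> real \<Rightarrow> ('w \<Rightarrow> 'x::real_normed_vector) \<Rightarrow> ennreal" where
  "simple_norm M p \<sigma> f =
     Inf {\<Sum>i<n. Phi M p \<sigma> (g i) | (n :: nat) g.
            (\<forall>i<n. simple_function M (g i)) \<and> (AE w in M. f w = (\<Sum>i<n. g i w))}"

definition approximating ::
  "'w measure \<Rightarrow> real \<Rightarrow> real \<Rightarrow> ('w \<Rightarrow> 'x::real_normed_vector) \<Rightarrow> (nat \<Rightarrow> 'w \<Rightarrow> 'x) \<Rightarrow> bool" where
  "approximating M p \<sigma> f s \<longleftrightarrow>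
     (\<forall>n. simple_function M (s n)) \<and>
     (\<forall>e>0. \<exists>N. \<forall>m\<ge>N. \<forall>n\<ge>N. simple_norm M p \<sigma> (\<lambda>w. s m w - s n w) < ennreal e) \<and>
     (\<lambda>n. pettis_norm M p (\<lambda>w. s n w - f w)) \<longlonglongrightarrow> 0"

definition sigma_space ::
  "'w measure \<Rightarrow> real \<Rightarrow> real \<Rightarrow> ('w \<Rightarrow> 'x::real_normed_vector) set" where
  "sigma_space M p \<sigma> = {f \<in> pettis_space M p. \<exists>s. approximating M p \<sigma> f s}"

definition sigma_norm ::
  "'w measure \<Rightarrow> real \<Rightarrow> real \<Rightarrow> ('w \<Rightarrow> 'x::real_normed_vector) \<Rightarrow> ennreal" where
  "sigma_norm M p \<sigma> f =
     Inf {L. \<exists>s. approximating M p \<sigma> f s \<and> (\<lambda>n. simple_norm M p \<sigma> (s n)) \<longlonglongrightarrow> L}"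

text \<open>Continuity of a map between function spaces on \<open>'w\<close> for the pseudometrics induced by two
  extended seminorms.\<close>

definition seminorm_continuous_on ::
  "('w \<Rightarrow> 'x::real_normed_vector) set \<Rightarrow> (('w \<Rightarrow> 'x) \<Rightarrow> ennreal) \<Rightarrow>
   (('w \<Rightarrow> 'y::real_normed_vector) \<Rightarrow> ennreal) \<Rightarrow> (('w \<Rightarrow> 'x) \<Rightarrow> ('w \<Rightarrow> 'y)) \<Rightarrow> bool" where
  "seminorm_continuous_on D N N' T \<longleftrightarrow>
     (\<forall>f\<in>D. \<forall>e>0. \<exists>d>0. \<forall>g\<in>D.
        N (\<lambda>w. g w - f w) < ennreal d \<longrightarrow> N' (\<lambda>w. T g w - T f w) < ennreal e)"

definition pq_summing ::
  "real \<Rightarrow> real \<Rightarrow> ('x::real_normed_vector \<Rightarrow> 'y::real_normed_vector) \<Rightarrow> bool" where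
  "pq_summing p q T \<longleftrightarrow> linear T \<and>
     (\<exists>C>0. \<forall>(n :: nat) (x :: nat \<Rightarrow> 'x).
        (\<Sum>i<n. norm (T (x i)) powr p) powr (1 / p)
        \<le> C * (SUP x' \<in> cball (0 :: 'x \<Rightarrow>\<^sub>L real) 1. (\<Sum>i<n. \<bar>blinfun_apply x' (x i)\<bar> powr q) powr (1 / q)))"

end

theory Submission
  imports Defs
begin

text \<open>All conditions are equivalent to Pisier's inequality
  \<open>\<Sum>i. m i * \<parallel>u (y i)\<parallel>\<^sup>p \<le> D * (SUP t. \<Sum>i. m i * \<bar>y i t\<bar> * \<parallel>y i\<parallel>\<^sup>p\<^sup>-\<^sup>1)\<close> with weights \<open>m i \<ge> 0\<close>.
  As \<open>1 - \<sigma> = 1 / p\<close>, the supremum is \<open>\<Phi>\<^sup>p\<close> of the simple function that takes the value \<open>y i\<close> on a set of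
  measure \<open>m i\<close>, so the inequality says that \<open>f \<mapsto> u \<circ> f\<close> is bounded on simple functions. It passes to
  the completion since the Bochner norm of \<open>u \<circ> f\<close> is lower semicontinuous under Pettis convergence.
  Summing operators satisfy it by Pisier's extremal argument, and conversely it yields
  \<open>(p, q)\<close>-summability by slicing functions at dyadic heights.\<close>

subsection \<open>Convexity of powers\<close>

text \<open>The exponent \<open>q\<close> does not occur in Pisier's inequality. On the way there it
  is lost, because a pointwise bound on the sum of the moduli also bounds the sums of
  \<open>q\<close>-th powers; on the way back \<open>q < p\<close> makes a geometric series
  converge. So the class of operators on C(K) obtained is the same for all \<open>q\<close> in [1,
  p). Pettis convergence controls one functional at a time and need not give almost everywhere
  convergence, even along a subsequence, so Fatou's lemma cannot be applied to
  \<open>norm (u (s n w))\<close>. Functionals do pass through means over sets, and the control is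
  uniform on the dual ball; hence the means converge in norm, and convexity brings the
  \<open>p\<close>-th powers back. Non-atomicity makes room for families of any length, placed on
  disjoint sets of positive measure.\<close>

lemma convex_on_powr_nonneg:
  assumes "p \<ge> 1"
  shows "convex_on {0::real..} (\<lambda>x. x powr p)"
proof (rule convex_onI)
  fix t x y :: real
  assume t: "0 < t" "t < 1" and xy: "x \<in> {0..}" "y \<in> {0..}"
  \<comment> \<open>If an endpoint is 0, convexity reduces to \<open>s powr p \<le> s\<close> for
    \<open>0 < s < 1\<close>; otherwise both points lie in the open half-line.\<close>
  have shrink: "(s * z) powr p \<le> s * z powr p" if "0 < s" "s < 1" "0 \<le> z" for s z :: real
  proof -
    have "s powr p \<le> s powr 1"
      using that assms by (intro powr_mono') auto
    then show ?thesis
      using that by (simp add: powr_mult mult_right_mono)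
  qed
  show "((1 - t) *\<^sub>R x + t *\<^sub>R y) powr p \<le> (1 - t) * x powr p + t * y powr p"
  proof (cases "x = 0 \<or> y = 0")
    case True
    then show ?thesis
      using shrink[of t y] shrink[of "1 - t" x] t xy by auto
  next
    case False
    then show ?thesis
      using convex_onD[OF powr_convex[OF assms], of t x y] t xy by auto
  qed
qed simp

lemma powr_sum_le:
  assumes "p \<ge> 1" "finite S" "sum c S = 1" "\<And>i. i \<in> S \<Longrightarrow> c i \<ge> 0" "\<And>i. i \<in> S \<Longrightarrow> a i \<ge> 0"
  shows "(\<Sum>i\<in>S. c i * a i) powr p \<le> (\<Sum>i\<in>S. c i * (a i) powr p :: real)"
proof -
  have "S \<noteq> {}"
    using assms(3) by auto
  from convex_on_sum[OF assms(2) this convex_on_powr_nonneg[OF assms(1)] assms(3)] assms(4,5)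
  show ?thesis
    by auto
qed

lemma norm_sum_powr_le:
  fixes v :: "'a \<Rightarrow> 'b::real_normed_vector"
  assumes "p \<ge> 1" "finite S" "sum c S = 1" "\<And>i. i \<in> S \<Longrightarrow> c i \<ge> 0"
  shows "norm (\<Sum>i\<in>S. c i *\<^sub>R v i) powr p \<le> (\<Sum>i\<in>S. c i * norm (v i) powr p)"
proof -
  have "norm (\<Sum>i\<in>S. c i *\<^sub>R v i) \<le> (\<Sum>i\<in>S. c i * norm (v i))"
    by (rule order.trans[OF norm_sum]) (use assms(4) in auto)
  then have "norm (\<Sum>i\<in>S. c i *\<^sub>R v i) powr p \<le> (\<Sum>i\<in>S. c i * norm (v i)) powr p"
    using assms(1) by (intro powr_mono2) auto
  also have "\<dots> \<le> (\<Sum>i\<in>S. c i * norm (v i) powr p)"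
    by (rule powr_sum_le) (use assms in auto)
  finally show ?thesis .
qed

text \<open>Jensen's inequality at the points \<open>a i / c i\<close>. Normalising weights of total
  \<open>C\<close> costs the factor \<open>C powr (p - 1) \<le> 1\<close>. With suitable weights
  this gives Minkowski's inequality and sums geometrically decaying slices.\<close>

lemma powr_sum_weighted_le:
  assumes "p \<ge> 1" "finite S" "sum c S \<le> 1" "\<And>i. i \<in> S \<Longrightarrow> c i > 0" "\<And>i. i \<in> S \<Longrightarrow> a i \<ge> 0"
  shows "(\<Sum>i\<in>S. a i) powr p \<le> (\<Sum>i\<in>S. c i * (a i / c i) powr p :: real)"
proof (cases "S = {}")
  case False
  define C where "C = sum c S"
  have C: "0 < C" "C \<le> 1"
    using False assms by (auto simp: C_def intro: sum_pos)
  have "(\<Sum>i\<in>S. a i) = (\<Sum>i\<in>S. (c i / C) * (C * (a i / c i)))"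
    using C assms(4) by (intro sum.cong) (auto simp: field_simps less_imp_neq[symmetric])
  also have "\<dots> powr p \<le> (\<Sum>i\<in>S. (c i / C) * (C * (a i / c i)) powr p)"
    using C assms(1,2,5) less_imp_le[OF assms(4)]
    by (intro powr_sum_le) (auto simp: C_def sum_divide_distrib[symmetric])
  also have "\<dots> \<le> (\<Sum>i\<in>S. c i * (a i / c i) powr p)"
  proof (rule sum_mono)
    fix i assume i: "i \<in> S"
    have "C powr p \<le> C powr 1"
      using C assms(1) by (intro powr_mono') auto
    then have "C powr p / C \<le> 1"
      using C by simp
    then have "C powr p / C * (c i * (a i / c i) powr p) \<le> 1 * (c i * (a i / c i) powr p)"
      using i assms(4)[OF i] by (intro mult_right_mono) auto
    moreover have "(C * (a i / c i)) powr p = C powr p * (a i / c i) powr p"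
      by (rule powr_mult)
    ultimately show "(c i / C) * (C * (a i / c i)) powr p \<le> c i * (a i / c i) powr p"
      by (simp add: field_simps)
  qed
  finally show ?thesis .
qed simp

subsection \<open>The space \<open>C(K)\<close>\<close>

lemma apply_Bcontfun:
  fixes f :: "'k::topological_space \<Rightarrow> real"
  assumes "compact (UNIV :: 'k set)" "continuous_on UNIV f"
  shows "apply_bcontfun (Bcontfun f) = f"
proof -
  have "bounded (range f)"
    using assms by (simp add: compact_continuous_image compact_imp_bounded)
  then show ?thesis
    using assms by (intro Bcontfun_inverse) (auto simp: bcontfun_def)
qed

lemma apply_bcontfun_sum: "apply_bcontfun (\<Sum>i\<in>S. f i) t = (\<Sum>i\<in>S. apply_bcontfun (f i) t)"
  for f :: "'a \<Rightarrow> 'k::topological_space \<Rightarrow>\<^sub>C real"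
  by (induction S rule: infinite_finite_induct) auto

lemma apply_bcontfun_linear [simp]:
  fixes f g :: "'k::topological_space \<Rightarrow>\<^sub>C real"
  shows "apply_bcontfun (f + g) t = apply_bcontfun f t + apply_bcontfun g t"
    "apply_bcontfun (f - g) t = apply_bcontfun f t - apply_bcontfun g t"
    "apply_bcontfun (c *\<^sub>R f) t = c * apply_bcontfun f t"
    "apply_bcontfun 0 t = 0"
  by auto

definition point_eval :: "'k::topological_space \<Rightarrow> ('k \<Rightarrow>\<^sub>C real) \<Rightarrow>\<^sub>L real" where
  "point_eval t = Blinfun (\<lambda>f. apply_bcontfun f t)"

lemma abs_apply_bcontfun_le: "\<bar>apply_bcontfun f t\<bar> \<le> norm f"
  for f :: "'k::topological_space \<Rightarrow>\<^sub>C real"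
  using norm_bounded[of f t] by simp

lemma point_eval_apply [simp]: "blinfun_apply (point_eval t) f = apply_bcontfun f t"
proof -
  have "bounded_linear (\<lambda>f. apply_bcontfun f t :: real)"
    by (rule bounded_linear_intro[of _ 1]) (auto simp: abs_apply_bcontfun_le)
  then show ?thesis
    by (simp add: point_eval_def bounded_linear_Blinfun_apply)
qed

lemma point_eval_in_cball: "point_eval t \<in> cball 0 1"
proof -
  have "norm (point_eval t) \<le> 1"
    by (rule norm_blinfun_bound) (auto simp: abs_apply_bcontfun_le)
  then show ?thesis
    by simp
qed

lemma norm_bcontfun_le_iff:
  fixes f :: "'k::topological_space \<Rightarrow>\<^sub>C real"
  shows "norm f \<le> b \<longleftrightarrow> (\<forall>t. \<bar>apply_bcontfun f t\<bar> \<le> b)"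
  using norm_bound[of f b] abs_apply_bcontfun_le[of f] order_trans by auto

text \<open>Choosing signs turns \<open>\<Sum>\<bar>x' (x i)\<bar>\<close> into a single value of the functional.\<close>

lemma sum_abs_dual_le:
  fixes x :: "'i \<Rightarrow> 'k::topological_space \<Rightarrow>\<^sub>C real"
  assumes "x' \<in> cball 0 1" and S: "\<And>t. (\<Sum>i\<in>I. \<bar>apply_bcontfun (x i) t\<bar>) \<le> S"
  shows "(\<Sum>i\<in>I. \<bar>blinfun_apply x' (x i)\<bar>) \<le> S"
proof -
  define z where "z = (\<Sum>i\<in>I. sgn (blinfun_apply x' (x i)) *\<^sub>R x i)"
  have "(\<Sum>i\<in>I. \<bar>blinfun_apply x' (x i)\<bar>) = blinfun_apply x' z"
    by (simp add: z_def blinfun.sum_right blinfun.scaleR_right abs_sgn mult.commute)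
  also have "\<dots> \<le> norm x' * norm z"
    using norm_blinfun[of x' z] by simp
  also have "\<dots> \<le> 1 * norm z"
    using assms(1) by (intro mult_right_mono) auto
  also have "norm z \<le> S"
  proof (subst norm_bcontfun_le_iff, rule allI)
    fix t
    have "\<bar>apply_bcontfun z t\<bar> \<le> (\<Sum>i\<in>I. \<bar>sgn (blinfun_apply x' (x i)) * apply_bcontfun (x i) t\<bar>)"
      by (simp add: z_def apply_bcontfun_sum sum_abs)
    also have "\<dots> \<le> (\<Sum>i\<in>I. \<bar>apply_bcontfun (x i) t\<bar>)"
      by (intro sum_mono) (auto simp: abs_mult abs_sgn_eq)
    finally show "\<bar>apply_bcontfun z t\<bar> \<le> S"
      using S[of t] by simp
  qed
  finally show ?thesis
    by simp
qed

subsection \<open>Pisier's inequality\<close>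

definition cmul :: "('k::topological_space \<Rightarrow>\<^sub>C real) \<Rightarrow> ('k \<Rightarrow>\<^sub>C real) \<Rightarrow> 'k \<Rightarrow>\<^sub>C real" where
  "cmul f g = Bcontfun (\<lambda>t. apply_bcontfun f t * apply_bcontfun g t)"

lemma apply_cmul:
  fixes f :: "'k::topological_space \<Rightarrow>\<^sub>C real"
  assumes "compact (UNIV :: 'k set)"
  shows "apply_bcontfun (cmul f g) t = apply_bcontfun f t * apply_bcontfun g t"
  unfolding cmul_def by (subst apply_Bcontfun[OF assms]) (auto intro!: continuous_intros)

lemma cmul_sum_right:
  fixes f :: "'k::topological_space \<Rightarrow>\<^sub>C real"
  assumes "compact (UNIV :: 'k set)"
  shows "cmul f (\<Sum>i\<in>I. c i *\<^sub>R g i) = (\<Sum>i\<in>I. c i *\<^sub>R cmul f (g i))"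
  by (rule bcontfun_eqI)
    (simp add: apply_cmul[OF assms] apply_bcontfun_sum sum_distrib_left mult.left_commute)

text \<open>The \<open>\<ell>\<^sub>q\<close>-sum is at most the \<open>\<ell>\<^sub>1\<close>-sum.\<close>

lemma pq_summing_l1_bound:
  fixes u :: "('k::topological_space \<Rightarrow>\<^sub>C real) \<Rightarrow> 'e::real_normed_vector"
  assumes "pq_summing p q u" "1 \<le> q" "q < p"
  obtains B where "B \<ge> 0"
    "\<And>n x. (\<And>t. (\<Sum>i<(n::nat). \<bar>apply_bcontfun (x i) t\<bar>) \<le> 1) \<Longrightarrow> (\<Sum>i<n. norm (u (x i)) powr p) \<le> B"
proof -
  from assms(1) obtain C where C: "C > 0" and
    *: "\<And>n x. (\<Sum>i<(n::nat). norm (u (x i)) powr p) powr (1 / p)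
        \<le> C * (SUP x' \<in> cball (0 :: ('k \<Rightarrow>\<^sub>C real) \<Rightarrow>\<^sub>L real) 1. (\<Sum>i<n. \<bar>blinfun_apply x' (x i)\<bar> powr q) powr (1 / q))"
    unfolding pq_summing_def by blast
  show ?thesis
  proof (rule that[of "C powr p"])
    fix n :: nat and x :: "nat \<Rightarrow> 'k \<Rightarrow>\<^sub>C real"
    assume x: "\<And>t. (\<Sum>i<n. \<bar>apply_bcontfun (x i) t\<bar>) \<le> 1"
    have "(\<Sum>i<n. \<bar>blinfun_apply x' (x i)\<bar> powr q) powr (1 / q) \<le> 1"
      if "x' \<in> cball 0 1" for x' :: "('k \<Rightarrow>\<^sub>C real) \<Rightarrow>\<^sub>L real"
    proof -
      have 1: "(\<Sum>i<n. \<bar>blinfun_apply x' (x i)\<bar>) \<le> 1"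
        by (rule sum_abs_dual_le[OF that x])
      have "(\<Sum>i<n. \<bar>blinfun_apply x' (x i)\<bar> powr q) \<le> (\<Sum>i<n. \<bar>blinfun_apply x' (x i)\<bar>)"
      proof (rule sum_mono)
        fix i assume "i \<in> {..<n}"
        then have "\<bar>blinfun_apply x' (x i)\<bar> \<le> (\<Sum>i<n. \<bar>blinfun_apply x' (x i)\<bar>)"
          by (intro member_le_sum) auto
        with 1 have "\<bar>blinfun_apply x' (x i)\<bar> powr q \<le> \<bar>blinfun_apply x' (x i)\<bar> powr 1"
          using assms(2) by (intro powr_mono') auto
        then show "\<bar>blinfun_apply x' (x i)\<bar> powr q \<le> \<bar>blinfun_apply x' (x i)\<bar>"
          by simp
      qed
      with 1 have "(\<Sum>i<n. \<bar>blinfun_apply x' (x i)\<bar> powr q) \<le> 1"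
        by simp
      then show ?thesis
        using assms(2) by (intro powr_le1) (simp_all add: sum_nonneg)
    qed
    then have "(SUP x' \<in> cball (0 :: ('k \<Rightarrow>\<^sub>C real) \<Rightarrow>\<^sub>L real) 1.
        (\<Sum>i<n. \<bar>blinfun_apply x' (x i)\<bar> powr q) powr (1 / q)) \<le> 1"
      by (intro cSUP_least) auto
    then have "(\<Sum>i<n. norm (u (x i)) powr p) powr (1 / p) \<le> C"
      using *[where n=n and x=x] C by (auto intro: order.trans mult_left_le)
    then have "((\<Sum>i<n. norm (u (x i)) powr p) powr (1 / p)) powr p \<le> C powr p"
      using assms by (intro powr_mono2) auto
    then show "(\<Sum>i<n. norm (u (x i)) powr p) \<le> C powr p"
      using assms by (simp add: powr_powr sum_nonneg)
  qed simp
qed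

text \<open>Take a nearly extremal family \<open>x\<close> for the best constant \<open>B\<close>. Adjoining \<open>y\<close> to
  \<open>x i * (1 - \<bar>y\<bar>)\<close> gives an admissible family, so \<open>\<parallel>u y\<parallel>\<^sup>p \<le> B - G (1 - \<bar>y\<bar>)\<close> for the convex
  functional \<open>G h = (\<Sum>i. \<parallel>u (x i * h)\<parallel>\<^sup>p)\<close>, and \<open>G 1\<close> is nearly \<open>B\<close>. Averaging over \<open>y\<close> needs only
  the convexity of \<open>G\<close>, and no representing measure.\<close>

lemma pisier_inequality_normalized:
  fixes u :: "('k::topological_space \<Rightarrow>\<^sub>C real) \<Rightarrow> 'e::real_normed_vector"
    and y :: "'i \<Rightarrow> 'k \<Rightarrow>\<^sub>C real"
  assumes K: "compact (UNIV :: 'k set)" and lin: "linear u" and p: "1 \<le> p"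
    and le: "\<And>n x. (\<And>t. (\<Sum>i<(n::nat). \<bar>apply_bcontfun (x i) t\<bar>) \<le> 1) \<Longrightarrow> (\<Sum>i<n. norm (u (x i)) powr p) \<le> B"
    and near: "\<And>e. e > 0 \<Longrightarrow> \<exists>n x. (\<forall>t. (\<Sum>i<(n::nat). \<bar>apply_bcontfun (x i) t\<bar>) \<le> 1) \<and> B - e < (\<Sum>i<n. norm (u (x i)) powr p)"
    and I: "finite I" "\<And>i. i \<in> I \<Longrightarrow> m i \<ge> 0" "sum m I = 1" "\<And>i. i \<in> I \<Longrightarrow> norm (y i) \<le> 1"
    and S: "0 \<le> S" "S \<le> 1" "\<And>t. (\<Sum>i\<in>I. m i * \<bar>apply_bcontfun (y i) t\<bar>) \<le> S"
  shows "(\<Sum>i\<in>I. m i * norm (u (y i)) powr p) \<le> 2 powr p * B * S"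
proof (rule field_le_epsilon)
  fix e :: real assume "e > 0"
  from near[OF this] obtain n :: nat and x where
    x: "\<And>t. (\<Sum>i<n. \<bar>apply_bcontfun (x i) t\<bar>) \<le> 1" and xB: "B - e < (\<Sum>i<n. norm (u (x i)) powr p)"
    by blast
  define G where "G h = (\<Sum>i<n. norm (u (cmul (x i) h)) powr p)" for h
  define h where "h j = Bcontfun (\<lambda>t. 1 - \<bar>apply_bcontfun (y j) t\<bar>)" for j
  define H where "H = (\<Sum>j\<in>I. m j *\<^sub>R h j)"
  note [simp] = apply_cmul[OF K]
  have h: "apply_bcontfun (h j) t = 1 - \<bar>apply_bcontfun (y j) t\<bar>" for j t
    unfolding h_def by (subst apply_Bcontfun[OF K]) (auto intro!: continuous_intros)
  have H: "apply_bcontfun H t = 1 - (\<Sum>i\<in>I. m i * \<bar>apply_bcontfun (y i) t\<bar>)" for t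
    using I(3) by (simp add: H_def apply_bcontfun_sum h right_diff_distrib sum_subtractf)
  have G_le: "norm (u (y j)) powr p \<le> B - G (h j)" if "j \<in> I" for j
  proof -
    define x' where "x' = (\<lambda>i. if i < n then cmul (x i) (h j) else y j)"
    have "(\<Sum>i<Suc n. \<bar>apply_bcontfun (x' i) t\<bar>) \<le> 1" for t
    proof -
      have y1: "\<bar>apply_bcontfun (y j) t\<bar> \<le> 1"
        using I(4)[OF that] abs_apply_bcontfun_le[of "y j" t] by simp
      have "(\<Sum>i<Suc n. \<bar>apply_bcontfun (x' i) t\<bar>)
          = (\<Sum>i<n. \<bar>apply_bcontfun (x i) t\<bar>) * (1 - \<bar>apply_bcontfun (y j) t\<bar>) + \<bar>apply_bcontfun (y j) t\<bar>"
        using y1 by (simp add: x'_def h abs_mult sum_distrib_right)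
      also have "\<dots> \<le> 1 * (1 - \<bar>apply_bcontfun (y j) t\<bar>) + \<bar>apply_bcontfun (y j) t\<bar>"
        using y1 x[of t] by (intro add_mono mult_right_mono) auto
      finally show ?thesis by simp
    qed
    from le[OF this] show ?thesis
      by (simp add: x'_def G_def)
  qed
  have conv: "G (\<Sum>j\<in>J. c j *\<^sub>R g j) \<le> (\<Sum>j\<in>J. c j * G (g j))"
    if "finite J" "sum c J = 1" "\<And>j. j \<in> J \<Longrightarrow> c j \<ge> 0" for J :: "'j set" and c g
  proof -
    have "G (\<Sum>j\<in>J. c j *\<^sub>R g j) = (\<Sum>i<n. norm (\<Sum>j\<in>J. c j *\<^sub>R u (cmul (x i) (g j))) powr p)"
      by (simp add: G_def cmul_sum_right[OF K] linear_sum[OF lin] linear_scale[OF lin])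
    also have "\<dots> \<le> (\<Sum>i<n. \<Sum>j\<in>J. c j * norm (u (cmul (x i) (g j))) powr p)"
      by (intro sum_mono norm_sum_powr_le p that)
    also have "\<dots> = (\<Sum>j\<in>J. c j * G (g j))"
      by (subst sum.swap) (simp add: G_def sum_distrib_left)
    finally show ?thesis .
  qed
  have B0: "0 \<le> B"
    using le[where n=0 and x="\<lambda>_. 0"] by simp
  have G0: "0 \<le> G g" for g
    by (simp add: G_def sum_nonneg)
  \<comment> \<open>The average \<open>H\<close> lies between \<open>1 - S\<close> and 1, so close
    to 1 that convexity forces \<open>G H\<close> to be close to the nearly extremal
    \<open>G one\<close>.\<close>
  have "B - e - 2 powr p * B * S \<le> G H"
  proof -
    obtain one :: "'k \<Rightarrow>\<^sub>C real" where one: "\<And>t. apply_bcontfun one t = 1"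
      using apply_Bcontfun[OF K, of "\<lambda>_. 1"] by (metis continuous_on_const)
    have "cmul (x i) one = x i" for i
      by (rule bcontfun_eqI) (simp add: one)
    then have G1: "B - e < G one"
      using xB by (simp add: G_def)
    show ?thesis
    \<comment> \<open>The construction below divides by \<open>S\<close>; for \<open>S = 0\<close>
      the average \<open>H\<close> is the constant 1 itself.\<close>
    proof (cases "S = 0")
      case True
      have "H = one"
      proof (rule bcontfun_eqI)
        fix t
        have "0 \<le> (\<Sum>i\<in>I. m i * \<bar>apply_bcontfun (y i) t\<bar>)"
          using I by (intro sum_nonneg) auto
        then show "apply_bcontfun H t = apply_bcontfun one t"
          using S(3)[of t] True by (simp add: H one)
      qed
      then show ?thesis
        using G1 True by simp
    next
      case False
      with S have S0: "S > 0" by simp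
      \<comment> \<open>Solved from \<open>one = (1 - S) H + S Z\<close>. As
        \<open>H = 1 - Y\<close> with \<open>0 \<le> Y \<le> S\<close>, it equals
        \<open>1 + (1 - S) Y / S\<close>, which lies between 1 and 2; this 2 is the source of the
        factor \<open>2 powr p\<close>.\<close>
      define Z where "Z = (1 / S) *\<^sub>R (one - (1 - S) *\<^sub>R H)"
      have Z: "\<bar>apply_bcontfun Z t\<bar> \<le> 2" for t
      proof -
        define Y where "Y = (\<Sum>i\<in>I. m i * \<bar>apply_bcontfun (y i) t\<bar>)"
        have Y: "0 \<le> Y" "Y \<le> S"
          using S(3)[of t] I by (auto simp: Y_def intro!: sum_nonneg)
        have "apply_bcontfun Z t = (1 - (1 - S) * (1 - Y)) / S"
          by (simp add: Z_def one H Y_def)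
        also have "\<dots> = 1 + (1 - S) * (Y / S)"
          using S0 by (simp add: field_simps)
        finally have "apply_bcontfun Z t = 1 + (1 - S) * (Y / S)" .
        moreover have "0 \<le> (1 - S) * (Y / S)" "(1 - S) * (Y / S) \<le> 1 * 1"
          using Y S S0 by (simp, intro mult_mono) auto
        ultimately show ?thesis
          by simp
      qed
      have "G ((1/2) *\<^sub>R Z) \<le> B"
        unfolding G_def
      proof (rule le)
        fix t
        have "(\<Sum>i<n. \<bar>apply_bcontfun (cmul (x i) ((1/2) *\<^sub>R Z)) t\<bar>)
            \<le> (\<Sum>i<n. \<bar>apply_bcontfun (x i) t\<bar>)"
          using Z[of t] by (intro sum_mono) (auto simp: abs_mult intro!: mult_left_mono)
        then show "(\<Sum>i<n. \<bar>apply_bcontfun (cmul (x i) ((1/2) *\<^sub>R Z)) t\<bar>) \<le> 1"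
          using x[of t] by simp
      qed
      moreover have "cmul (x i) Z = 2 *\<^sub>R cmul (x i) ((1/2) *\<^sub>R Z)" for i
        by (rule bcontfun_eqI) simp
      then have "G Z = 2 powr p * G ((1/2) *\<^sub>R Z)"
        by (simp add: G_def linear_scale[OF lin] powr_mult sum_distrib_left)
      ultimately have GZ: "G Z \<le> 2 powr p * B"
        by simp
      have "one = (1 - S) *\<^sub>R H + S *\<^sub>R Z"
        using S0 by (intro bcontfun_eqI) (simp add: Z_def)
      also have "\<dots> = (\<Sum>j\<in>UNIV. (if j then 1 - S else S) *\<^sub>R (if j then H else Z))"
        by (simp add: UNIV_bool add.commute)
      also have "G \<dots> \<le> (\<Sum>j\<in>UNIV. (if j then 1 - S else S) * G (if j then H else Z))"
        by (rule conv) (use S in \<open>auto simp: UNIV_bool\<close>)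
      also have "\<dots> = (1 - S) * G H + S * G Z"
        by (simp add: UNIV_bool add.commute)
      also have "\<dots> \<le> 1 * G H + S * (2 powr p * B)"
        using S G0[of H] GZ by (intro add_mono mult_right_mono mult_left_mono) auto
      finally show ?thesis
        using G1 by (simp add: algebra_simps)
    qed
  qed
  moreover have "G H \<le> (\<Sum>j\<in>I. m j * G (h j))"
    unfolding H_def by (rule conv) (use I in auto)
  moreover have "(\<Sum>j\<in>I. m j * norm (u (y j)) powr p) \<le> (\<Sum>j\<in>I. m j * (B - G (h j)))"
    by (intro sum_mono mult_left_mono G_le I)
  moreover have "(\<Sum>j\<in>I. m j * (B - G (h j))) = B - (\<Sum>j\<in>I. m j * G (h j))"
    using I(3) by (simp add: right_diff_distrib sum_subtractf sum_distrib_right[symmetric])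
  ultimately show "(\<Sum>i\<in>I. m i * norm (u (y i)) powr p) \<le> 2 powr p * B * S + e"
    by simp
qed

text \<open>By homogeneity each \<open>y i\<close> may be replaced by its normalisation
  \<open>z i\<close>, with \<open>norm (y i) powr p\<close> moved into the weight
  \<open>w i\<close>; dividing by the total weight \<open>W\<close> leads to the normalised case
  with \<open>S / W\<close> for \<open>S\<close>. If \<open>S / W > 1\<close>, the families
  consisting of a single vector already suffice. The index type is arbitrary because the values of a
  simple function will serve as indices.\<close>

lemma pisier_inequality:
  fixes u :: "('k::topological_space \<Rightarrow>\<^sub>C real) \<Rightarrow> 'e::real_normed_vector"
  assumes K: "compact (UNIV :: 'k set)" and u: "pq_summing p q u" and pq: "1 \<le> q" "q < p"
  obtains D where "D \<ge> 0"
    "\<And>(I :: 'i set) m (y :: 'i \<Rightarrow> 'k \<Rightarrow>\<^sub>C real) S.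
      \<lbrakk>finite I; \<And>i. i \<in> I \<Longrightarrow> m i \<ge> 0; \<And>t. (\<Sum>i\<in>I. m i * (\<bar>apply_bcontfun (y i) t\<bar> * norm (y i) powr (p - 1))) \<le> S\<rbrakk>
      \<Longrightarrow> (\<Sum>i\<in>I. m i * norm (u (y i)) powr p) \<le> D * S"
proof -
  have lin: "linear u"
    using u by (simp add: pq_summing_def)
  define V where "V = {\<Sum>i<n. norm (u (x i)) powr p | (n::nat) x. \<forall>t. (\<Sum>i<n. \<bar>apply_bcontfun (x i) t\<bar>) \<le> 1}"
  define B where "B = Sup V"
  obtain B' where B': "B' \<ge> 0"
    "\<And>n x. (\<And>t. (\<Sum>i<(n::nat). \<bar>apply_bcontfun (x i) t\<bar>) \<le> 1) \<Longrightarrow> (\<Sum>i<n. norm (u (x i)) powr p) \<le> B'"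
    using pq_summing_l1_bound[OF u pq] by metis
  have bdd: "bdd_above V"
    unfolding V_def bdd_above_def using B'(2) by blast
  have "(\<Sum>i<(0::nat). norm (u 0) powr p) \<in> V"
    unfolding V_def by (rule CollectI, rule exI[of _ 0], rule exI[of _ "\<lambda>_. 0"]) simp
  then have V0: "0 \<in> V"
    by simp
  have le: "(\<Sum>i<n. norm (u (x i)) powr p) \<le> B"
    if "\<And>t. (\<Sum>i<n. \<bar>apply_bcontfun (x i) t\<bar>) \<le> 1" for n :: nat and x
    unfolding B_def using that by (intro cSup_upper[OF _ bdd]) (auto simp: V_def)
  have near: "\<exists>n x. (\<forall>t. (\<Sum>i<(n::nat). \<bar>apply_bcontfun (x i) t\<bar>) \<le> 1) \<and> B - e < (\<Sum>i<n. norm (u (x i)) powr p)"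
    if "e > 0" for e
  proof -
    have "B - e < Sup V"
      using that by (simp add: B_def)
    then obtain v where "v \<in> V" "B - e < v"
      using less_cSup_iff[of V "B - e"] bdd V0 by auto
    then show ?thesis
      unfolding V_def by blast
  qed
  have B0: "0 \<le> B"
    unfolding B_def by (rule cSup_upper[OF V0 bdd])
  have p1: "1 \<le> p"
    using pq by simp
  show ?thesis
  proof (rule that)
    show "0 \<le> 2 powr p * B"
      using B0 by simp
    fix I :: "'i set" and m and y :: "'i \<Rightarrow> 'k \<Rightarrow>\<^sub>C real" and S
    assume I: "finite I" "\<And>i. i \<in> I \<Longrightarrow> m i \<ge> 0"
      and S: "\<And>t. (\<Sum>i\<in>I. m i * (\<bar>apply_bcontfun (y i) t\<bar> * norm (y i) powr (p - 1))) \<le> S"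
    define w where "w i = m i * norm (y i) powr p" for i
    define z where "z i = (1 / norm (y i)) *\<^sub>R y i" for i
    define W where "W = sum w I"
    have w0: "w i \<ge> 0" if "i \<in> I" for i
      using I(2)[OF that] by (simp add: w_def)
    \<comment> \<open>For \<open>y i = 0\<close> both sides vanish, since
      \<open>0 powr a = 0\<close>.\<close>
    have weq: "w i * (s / norm (y i)) = m i * (s * norm (y i) powr (p - 1))" for i s
      by (cases "y i = 0") (auto simp: w_def powr_diff)
    have u_eq: "m i * norm (u (y i)) powr p = w i * norm (u (z i)) powr p" for i
      by (cases "y i = 0")
        (auto simp: w_def z_def linear_0[OF lin] linear_scale[OF lin] powr_divide)
    have S0: "0 \<le> S"
      using I by (intro order.trans[OF sum_nonneg S]) auto
    show "(\<Sum>i\<in>I. m i * norm (u (y i)) powr p) \<le> 2 powr p * B * S"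
    proof (cases "W = 0")
      case True
      then have "w i = 0" if "i \<in> I" for i
        using that w0 I(1) by (simp add: W_def sum_nonneg_eq_0_iff)
      then show ?thesis
        using S0 B0 by (simp add: u_eq)
    next
      case False
      then have W: "W > 0"
        using w0 by (simp add: W_def order.not_eq_order_implies_strict sum_nonneg)
      have norm_z: "norm (z i) \<le> 1" for i
        by (simp add: z_def)
      have Sz: "(\<Sum>i\<in>I. w i / W * \<bar>apply_bcontfun (z i) t\<bar>) \<le> S / W" for t
      proof -
        have "(\<Sum>i\<in>I. w i / W * \<bar>apply_bcontfun (z i) t\<bar>)
            = (\<Sum>i\<in>I. m i * (\<bar>apply_bcontfun (y i) t\<bar> * norm (y i) powr (p - 1))) / W"
          by (simp add: weq[symmetric] sum_divide_distrib z_def abs_mult mult.commute)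
        also have "\<dots> \<le> S / W"
          using W S by (intro divide_right_mono) auto
        finally show ?thesis .
      qed
      have w1: "(\<Sum>i\<in>I. w i / W) = 1"
        using W by (simp add: W_def sum_divide_distrib[symmetric])
      have "(\<Sum>i\<in>I. w i / W * norm (u (z i)) powr p) \<le> 2 powr p * B * (S / W)"
      proof (cases "S / W \<le> 1")
        case True
        show ?thesis
          by (rule pisier_inequality_normalized[OF K lin p1 le near I(1) _ w1 norm_z _ True Sz])
            (use W w0 S0 in auto)
      next
        case False
        have "norm (u (z i)) powr p \<le> B" for i
          using le[where n=1 and x="\<lambda>_. z i"] norm_z[of i] abs_apply_bcontfun_le[of "z i"]
          by (auto intro: order.trans)
        then have "(\<Sum>i\<in>I. w i / W * norm (u (z i)) powr p) \<le> (\<Sum>i\<in>I. w i / W * B)"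
          using w0 W by (intro sum_mono mult_left_mono) auto
        also have "\<dots> = 1 * B * 1"
          by (simp only: sum_distrib_right[symmetric] w1 mult_1_right)
        also have "\<dots> \<le> 2 powr p * B * (S / W)"
          using False B0 p1 by (intro mult_mono) (auto simp: ge_one_powr_ge_zero)
        finally show ?thesis .
      qed
      then have "(\<Sum>i\<in>I. w i * norm (u (z i)) powr p) / W \<le> (2 powr p * B * S) / W"
        by (simp add: sum_divide_distrib)
      then show ?thesis
        using W by (simp add: u_eq divide_le_cancel)
    qed
  qed
qed

subsection \<open>From Pisier's inequality back to \<open>(p, q)\<close>-summing operators\<close>

definition trunc :: "real \<Rightarrow> ('k::topological_space \<Rightarrow>\<^sub>C real) \<Rightarrow> 'k \<Rightarrow>\<^sub>C real" where
  "trunc r f = Bcontfun (\<lambda>t. max (- r) (min r (apply_bcontfun f t)))"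

lemma apply_trunc:
  fixes f :: "'k::topological_space \<Rightarrow>\<^sub>C real"
  assumes "compact (UNIV :: 'k set)"
  shows "apply_bcontfun (trunc r f) t = max (- r) (min r (apply_bcontfun f t))"
  unfolding trunc_def by (subst apply_Bcontfun[OF assms]) (auto intro!: continuous_intros)

text \<open>Slicing \<open>x i\<close> at the heights \<open>2\<^sup>-\<^sup>k\<close>, the \<open>k\<close>-th slice has norm at most \<open>2\<^sup>-\<^sup>k\<close> and is at most
  \<open>2\<^sup>-\<^sup>k (2\<^sup>k \<bar>x i\<bar>)\<^sup>q\<close>, so the \<open>\<ell>\<^sub>p\<close>-norms of the images of the slices decay geometrically as
  \<open>q < p\<close>.\<close>

lemma lq_bound:
  fixes u :: "('k::topological_space \<Rightarrow>\<^sub>C real) \<Rightarrow> 'e::real_normed_vector"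
    and x :: "nat \<Rightarrow> 'k \<Rightarrow>\<^sub>C real"
  assumes K: "compact (UNIV :: 'k set)" and u: "bounded_linear u" and pq: "1 \<le> q" "q < p"
    and D: "D \<ge> 0" "\<And>n x r S. \<lbrakk>r > 0; \<And>i. i < (n::nat) \<Longrightarrow> norm (x i) \<le> r; \<And>t. (\<Sum>i<n. \<bar>apply_bcontfun (x i) t\<bar>) \<le> S\<rbrakk>
      \<Longrightarrow> (\<Sum>i<n. norm (u (x i)) powr p) \<le> D * r powr (p - 1) * S"
    and x: "\<And>t. (\<Sum>i<n. \<bar>apply_bcontfun (x i) t\<bar> powr q) \<le> 1"
    and \<rho>_def: "\<rho> = (1/2) powr (1 - q / p)"
  shows "(\<Sum>i<n. norm (u (x i)) powr p) \<le> D * (\<rho> / (1 - \<rho>)) powr p"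
proof -
  interpret u: bounded_linear u by fact
  have \<rho>: "0 < \<rho>" "\<rho> < 1"
  proof -
    have "(1/2::real) powr (1 - q / p) < (1/2) powr 0"
      using pq by (intro powr_less_mono') auto
    then show "0 < \<rho>" "\<rho> < 1"
      by (auto simp: \<rho>_def)
  qed
  define T where "T k i = trunc ((1/2)^k) (x i)" for k i
  define z where "z k i = T k i - T (Suc k) i" for k i
  have T: "apply_bcontfun (T k i) t = max (- ((1/2)^k)) (min ((1/2)^k) (apply_bcontfun (x i) t))" for k i t
    by (simp add: T_def apply_trunc[OF K])
  have x1: "\<bar>apply_bcontfun (x i) t\<bar> \<le> 1" if "i < n" for i t
  proof -
    have "\<bar>apply_bcontfun (x i) t\<bar> powr q \<le> (\<Sum>i<n. \<bar>apply_bcontfun (x i) t\<bar> powr q)"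
      using that by (intro member_le_sum) auto
    with x[of t] have "\<bar>apply_bcontfun (x i) t\<bar> powr q \<le> 1 powr q"
      by simp
    then show ?thesis
      using pq powr_less_mono2[of q 1 "\<bar>apply_bcontfun (x i) t\<bar>"] by fastforce
  qed
  \<comment> \<open>The slices telescope from height 1 downwards, and truncation at height 1 leaves
    \<open>x i\<close> unchanged.\<close>
  have T0: "T 0 i = x i" if "i < n" for i
  proof (rule bcontfun_eqI)
    fix t
    show "apply_bcontfun (T 0 i) t = apply_bcontfun (x i) t"
      using x1[OF that, of t] by (auto simp: T min_def max_def)
  qed
  have z_le: "\<bar>apply_bcontfun (z k i) t\<bar> \<le> (1/2)^Suc k"
    and z_0: "\<bar>apply_bcontfun (x i) t\<bar> \<le> (1/2)^Suc k \<Longrightarrow> apply_bcontfun (z k i) t = 0" for k i t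
  proof -
    \<comment> \<open>Slice \<open>k\<close> lies between the heights \<open>r\<close> and
      \<open>2 * r\<close> with \<open>r = (1/2)^Suc k\<close>, so it is bounded by \<open>r\<close>
      and vanishes where \<open>\<bar>x i\<bar> \<le> r\<close>.\<close>
    define r :: real where "r = (1/2)^Suc k"
    have "r > 0" and "apply_bcontfun (z k i) t
        = max (- (2 * r)) (min (2 * r) (apply_bcontfun (x i) t)) - max (- r) (min r (apply_bcontfun (x i) t))"
      by (simp_all add: z_def T r_def)
    then show "\<bar>apply_bcontfun (z k i) t\<bar> \<le> (1/2)^Suc k"
      "\<bar>apply_bcontfun (x i) t\<bar> \<le> (1/2)^Suc k \<Longrightarrow> apply_bcontfun (z k i) t = 0"
      unfolding r_def[symmetric] by (auto simp: min_def max_def abs_if split: if_splits)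
  qed
  have slice: "(\<Sum>i<n. norm (u (z k i)) powr p) \<le> D * (\<rho> ^ Suc k) powr p" for k
  proof -
    define r :: real where "r = (1/2)^Suc k"
    have r: "r > 0"
      by (simp add: r_def)
    have "\<bar>apply_bcontfun (z k i) t\<bar> \<le> r powr (1 - q) * \<bar>apply_bcontfun (x i) t\<bar> powr q" for i t
    proof (cases "\<bar>apply_bcontfun (x i) t\<bar> \<le> r")
      case True
      then show ?thesis
        using z_0 by (simp add: r_def)
    next
      case False
      then have "r powr q \<le> \<bar>apply_bcontfun (x i) t\<bar> powr q"
        using r pq by (intro powr_mono2) auto
      then have "r powr (1 - q) * r powr q \<le> r powr (1 - q) * \<bar>apply_bcontfun (x i) t\<bar> powr q"
        by (intro mult_left_mono) auto
      then show ?thesis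
        using z_le[of k i t] r by (simp add: r_def[symmetric] powr_add[symmetric] del: power_Suc)
    qed
    then have "(\<Sum>i<n. \<bar>apply_bcontfun (z k i) t\<bar>) \<le> (\<Sum>i<n. r powr (1 - q) * \<bar>apply_bcontfun (x i) t\<bar> powr q)" for t
      by (intro sum_mono)
    also have "(\<Sum>i<n. r powr (1 - q) * \<bar>apply_bcontfun (x i) t\<bar> powr q) \<le> r powr (1 - q)" for t
      using mult_left_mono[OF x[of t], of "r powr (1 - q)"] by (simp add: sum_distrib_left)
    finally have z_sum: "(\<Sum>i<n. \<bar>apply_bcontfun (z k i) t\<bar>) \<le> r powr (1 - q)" for t .
    \<comment> \<open>The two exponents add up to \<open>p - q\<close>, and
      \<open>r powr (p - q)\<close> is the \<open>p\<close>-th power of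
      \<open>\<rho> ^ Suc k\<close>. This is the origin of \<open>\<rho>\<close>, which is below 1
      because \<open>q < p\<close>.\<close>
    have "(\<Sum>i<n. norm (u (z k i)) powr p) \<le> D * r powr (p - 1) * r powr (1 - q)"
      by (rule D(2)[OF r _ z_sum]) (unfold norm_bcontfun_le_iff r_def, use z_le in blast)
    also have "\<dots> = D * r powr (p - q)"
      by (simp add: powr_add[symmetric])
    also have "\<rho> ^ Suc k = r powr (1 - q / p)"
      by (simp only: \<rho>_def r_def powr_power powr_realpow[symmetric] powr_powr mult.commute)
    then have "r powr (p - q) = (\<rho> ^ Suc k) powr p"
      using pq by (simp add: powr_powr left_diff_distrib)
    finally show ?thesis .
  qed
  have partial: "(\<Sum>i<n. norm (u (x i - T m i)) powr p) \<le> D * (\<rho> / (1 - \<rho>)) powr p" for m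
  proof -
    \<comment> \<open>Weights proportional to the decay of the slices, of total at most 1. The
      quotient \<open>\<rho> ^ Suc k / c k\<close> is then \<open>\<rho> / (1 - \<rho>)\<close> for
      every \<open>k\<close>, the constant in the claim.\<close>
    define c where "c k = (1 - \<rho>) * \<rho> ^ k" for k
    have c0: "c k > 0" for k
      using \<rho> by (simp add: c_def)
    have "sum c {..<m} = 1 - \<rho> ^ m"
      by (simp add: c_def sum_distrib_left[symmetric] one_diff_power_eq)
    then have c1: "sum c {..<m} \<le> 1"
      using \<rho> by simp
    have "norm (u (x i - T m i)) powr p \<le> (\<Sum>k<m. c k * (norm (u (z k i)) / c k) powr p)"
      if "i < n" for i
    proof -
      have "x i - T m i = (\<Sum>k<m. z k i)"
        using sum_lessThan_telescope'[of "\<lambda>k. T k i" m] T0[OF that] by (simp add: z_def)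
      then have "norm (u (x i - T m i)) \<le> (\<Sum>k<m. norm (u (z k i)))"
        by (simp add: u.sum norm_sum)
      then have "norm (u (x i - T m i)) powr p \<le> (\<Sum>k<m. norm (u (z k i))) powr p"
        using pq by (intro powr_mono2) auto
      also have "\<dots> \<le> (\<Sum>k<m. c k * (norm (u (z k i)) / c k) powr p)"
        using pq by (intro powr_sum_weighted_le c1 c0) auto
      finally show ?thesis .
    qed
    then have "(\<Sum>i<n. norm (u (x i - T m i)) powr p)
        \<le> (\<Sum>i<n. \<Sum>k<m. c k * (norm (u (z k i)) / c k) powr p)"
      by (intro sum_mono) auto
    also have "\<dots> = (\<Sum>k<m. c k / c k powr p * (\<Sum>i<n. norm (u (z k i)) powr p))"
      using c0 by (subst sum.swap) (simp add: sum_distrib_left powr_divide less_imp_le)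
    also have "\<dots> \<le> (\<Sum>k<m. c k / c k powr p * (D * (\<rho> ^ Suc k) powr p))"
      using c0 by (intro sum_mono mult_left_mono slice) (simp add: less_imp_le)
    also have "\<dots> = (\<Sum>k<m. c k) * (D * (\<rho> / (1 - \<rho>)) powr p)"
      unfolding sum_distrib_right
    proof (rule sum.cong)
      fix k
      have "(\<rho> ^ Suc k) powr p / c k powr p = (\<rho> / (1 - \<rho>)) powr p"
        using \<rho> by (subst powr_divide[symmetric]) (auto simp: c_def)
      then show "c k / c k powr p * (D * (\<rho> ^ Suc k) powr p) = c k * (D * (\<rho> / (1 - \<rho>)) powr p)"
        by (metis (no_types, lifting) mult.left_commute times_divide_eq_left times_divide_eq_right)
    qed simp
    also have "\<dots> \<le> 1 * (D * (\<rho> / (1 - \<rho>)) powr p)"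
      using D(1) by (intro mult_right_mono c1) auto
    finally show ?thesis by simp
  qed
  \<comment> \<open>The first \<open>m\<close> slices only reach down to height
    \<open>(1/2)^m\<close>; continuity of \<open>u\<close> recovers the whole of
    \<open>x i\<close>.\<close>
  have "(\<lambda>m. T m i) \<longlonglongrightarrow> 0" for i
  proof (rule Lim_null_comparison)
    show "\<forall>\<^sub>F m in sequentially. norm (T m i) \<le> (1/2) ^ m"
      by (intro always_eventually allI) (auto simp: norm_bcontfun_le_iff T min_def max_def abs_if)
  qed (simp add: LIMSEQ_power_zero)
  then have "(\<lambda>m. \<Sum>i<n. norm (u (x i - T m i)) powr p) \<longlonglongrightarrow> (\<Sum>i<n. norm (u (x i - 0)) powr p)"
    using pq by (intro tendsto_sum tendsto_powr' tendsto_norm u.tendsto tendsto_diff tendsto_const) auto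
  then show ?thesis
    using partial by (intro LIMSEQ_le_const2) auto
qed

text \<open>Both sides of the summing inequality are homogeneous, so the family may be divided by
  the supremum \<open>W\<close> on the right. Point evaluations lie in the dual ball and turn this
  normalisation into the pointwise bound that \<open>lq_bound\<close> asks for.\<close>

lemma pq_summing_if_pisier:
  fixes u :: "('k::topological_space \<Rightarrow>\<^sub>C real) \<Rightarrow> 'e::real_normed_vector"
  assumes K: "compact (UNIV :: 'k set)" and u: "bounded_linear u" and pq: "1 \<le> q" "q < p"
    and D: "D \<ge> 0" "\<And>n x r S. \<lbrakk>r > 0; \<And>i. i < (n::nat) \<Longrightarrow> norm (x i) \<le> r; \<And>t. (\<Sum>i<n. \<bar>apply_bcontfun (x i) t\<bar>) \<le> S\<rbrakk>
      \<Longrightarrow> (\<Sum>i<n. norm (u (x i)) powr p) \<le> D * r powr (p - 1) * S"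
  shows "pq_summing p q u"
proof -
  interpret u: bounded_linear u by fact
  define \<rho> :: real where "\<rho> = (1/2) powr (1 - q / p)"
  \<comment> \<open>The summand 1 makes the constant strictly positive, as \<open>pq_summing\<close>
    demands.\<close>
  define C where "C = (D * (\<rho> / (1 - \<rho>)) powr p) powr (1 / p) + 1"
  have C0: "C > 0"
    by (simp add: C_def add_nonneg_pos)
  have "(\<Sum>i<n. norm (u (x i)) powr p) powr (1 / p)
        \<le> C * (SUP x' \<in> cball (0 :: ('k \<Rightarrow>\<^sub>C real) \<Rightarrow>\<^sub>L real) 1. (\<Sum>i<n. \<bar>blinfun_apply x' (x i)\<bar> powr q) powr (1 / q))"
    (is "_ \<le> C * ?W") for n :: nat and x :: "nat \<Rightarrow> 'k \<Rightarrow>\<^sub>C real"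
  proof -
    \<comment> \<open>A real supremum dominates its terms only over a set that is bounded
      above.\<close>
    have "bdd_above ((\<lambda>x'. (\<Sum>i<n. \<bar>blinfun_apply x' (x i)\<bar> powr q) powr (1 / q)) ` cball (0 :: ('k \<Rightarrow>\<^sub>C real) \<Rightarrow>\<^sub>L real) 1)"
    proof (rule bdd_aboveI2)
      fix x' :: "('k \<Rightarrow>\<^sub>C real) \<Rightarrow>\<^sub>L real" assume "x' \<in> cball 0 1"
      then have "\<bar>blinfun_apply x' y\<bar> \<le> norm y" for y
        using norm_blinfun[of x' y] mult_right_mono[of "norm x'" 1 "norm y"] by auto
      then show "(\<Sum>i<n. \<bar>blinfun_apply x' (x i)\<bar> powr q) powr (1 / q) \<le> (\<Sum>i<n. norm (x i) powr q) powr (1 / q)"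
        using pq by (intro powr_mono2 sum_mono) (auto intro!: sum_nonneg)
    qed
    from cSUP_upper[OF point_eval_in_cball this]
    have W: "(\<Sum>i<n. \<bar>apply_bcontfun (x i) t\<bar> powr q) powr (1 / q) \<le> ?W" for t
      by simp
    have W0: "0 \<le> ?W"
      by (rule order.trans[OF _ W]) simp
    have Wq: "(\<Sum>i<n. \<bar>apply_bcontfun (x i) t\<bar> powr q) \<le> ?W powr q" for t
    proof -
      have "((\<Sum>i<n. \<bar>apply_bcontfun (x i) t\<bar> powr q) powr (1 / q)) powr q \<le> ?W powr q"
        using pq by (intro powr_mono2 W) auto
      then show ?thesis
        using pq by (simp add: powr_powr sum_nonneg)
    qed
    show ?thesis
    proof (cases "?W = 0")
      case True
      have "x i = 0" if "i < n" for i
      proof (rule bcontfun_eqI)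
        fix t
        have "\<bar>apply_bcontfun (x i) t\<bar> powr q \<le> (\<Sum>i<n. \<bar>apply_bcontfun (x i) t\<bar> powr q)"
          using that by (intro member_le_sum) auto
        also have "\<dots> \<le> 0"
          using Wq[of t] True by simp
        finally have "\<bar>apply_bcontfun (x i) t\<bar> powr q = 0"
          by (intro antisym) auto
        then show "apply_bcontfun (x i) t = apply_bcontfun 0 t"
          by simp
      qed
      then show ?thesis
        using True by (simp add: u.zero)
    next
      case False
      define W where "W = ?W"
      have "W > 0"
        using False W0 by (simp add: W_def)
      have "(\<Sum>i<n. norm (u ((1 / W) *\<^sub>R x i)) powr p) \<le> D * (\<rho> / (1 - \<rho>)) powr p"
      proof (rule lq_bound[OF K u pq D _ \<rho>_def])
        fix t
        show "(\<Sum>i<n. \<bar>apply_bcontfun ((1 / W) *\<^sub>R x i) t\<bar> powr q) \<le> 1"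
          using \<open>W > 0\<close> Wq[of t]
          by (simp add: W_def[symmetric] abs_mult powr_divide sum_divide_distrib[symmetric])
      qed assumption+
      also have "(\<Sum>i<n. norm (u ((1 / W) *\<^sub>R x i)) powr p) = (\<Sum>i<n. norm (u (x i)) powr p) / W powr p"
        using \<open>W > 0\<close> by (simp add: u.scaleR powr_divide sum_divide_distrib)
      finally have "((\<Sum>i<n. norm (u (x i)) powr p) / W powr p) powr (1 / p) \<le> C - 1"
        using pq \<open>W > 0\<close> unfolding C_def
        by (simp, intro powr_mono2) (auto intro!: divide_nonneg_nonneg sum_nonneg)
      then have "(\<Sum>i<n. norm (u (x i)) powr p) powr (1 / p) / W \<le> C"
        using pq \<open>W > 0\<close> by (simp add: powr_divide powr_powr sum_nonneg)
      then show ?thesis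
        using \<open>W > 0\<close> by (simp add: W_def[symmetric] divide_le_eq)
    qed
  qed
  with C0 u show ?thesis
    unfolding pq_summing_def by (auto simp: bounded_linear.linear)
qed

subsection \<open>Integrals and \<open>L\<^sup>p\<close> norms\<close>

lemma Lp_norm_le_iff:
  assumes "p > 0" "c \<ge> 0"
  shows "Lp_norm M p f \<le> ennreal c \<longleftrightarrow> (\<integral>\<^sup>+ w. ennreal (\<bar>f w\<bar> powr p) \<partial>M) \<le> ennreal (c powr p)"
proof (cases "\<integral>\<^sup>+ w. ennreal (\<bar>f w\<bar> powr p) \<partial>M")
  case (real r)
  have "r powr (1 / p) \<le> c \<longleftrightarrow> r \<le> c powr p"
  proof
    assume "r powr (1 / p) \<le> c"
    then have "(r powr (1 / p)) powr p \<le> c powr p"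
      using assms by (intro powr_mono2) auto
    then show "r \<le> c powr p"
      using assms real by (simp add: powr_powr)
  next
    assume "r \<le> c powr p"
    then have "r powr (1 / p) \<le> (c powr p) powr (1 / p)"
      using assms real by (intro powr_mono2) auto
    then show "r powr (1 / p) \<le> c"
      using assms by (simp add: powr_powr)
  qed
  with real assms show ?thesis
    by (simp add: Lp_norm_def Let_def)
next
  case top
  then show ?thesis
    by (simp add: Lp_norm_def Let_def top_unique)
qed

lemma Lp_norm_cong_AE:
  "AE w in M. \<bar>f w\<bar> = \<bar>g w\<bar> \<Longrightarrow> Lp_norm M p f = Lp_norm M p g"
  unfolding Lp_norm_def
  by (subst nn_integral_cong_AE[of "\<lambda>w. ennreal (\<bar>f w\<bar> powr p)" "\<lambda>w. ennreal (\<bar>g w\<bar> powr p)"]) auto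

text \<open>Splitting over the finitely many level sets works for any value space. The set
  \<open>A\<close> is there for means of \<open>g\<close> over parts of the space.\<close>

lemma nn_integral_simple_on:
  assumes "finite_measure M" "simple_function M g" "A \<in> sets M" "\<And>y. \<phi> y \<ge> 0"
  shows "(\<integral>\<^sup>+ w \<in> A. ennreal (\<phi> (g w)) \<partial>M)
    = ennreal (\<Sum>y\<in>g ` space M. measure M (g -` {y} \<inter> space M \<inter> A) * \<phi> y)"
proof -
  interpret finite_measure M by fact
  have [measurable]: "g -` {y} \<inter> space M \<inter> A \<in> sets M" for y
    using simple_functionD(2)[OF assms(2)] assms(3) by auto
  have fin: "finite (g ` space M)"
    using assms(2) by (simp add: simple_function_def)
  have "(\<integral>\<^sup>+ w \<in> A. ennreal (\<phi> (g w)) \<partial>M)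
      = (\<integral>\<^sup>+ w. (\<Sum>y\<in>g ` space M. ennreal (\<phi> y) * indicator (g -` {y} \<inter> space M \<inter> A) w) \<partial>M)"
  proof (rule nn_integral_cong)
    fix w assume w: "w \<in> space M"
    have "(\<Sum>y\<in>g ` space M. ennreal (\<phi> y) * indicator (g -` {y} \<inter> space M \<inter> A) w)
        = (\<Sum>y\<in>g ` space M. if y = g w then ennreal (\<phi> y) * indicator A w else 0)"
      by (rule sum.cong) (auto simp: indicator_def w)
    also have "\<dots> = ennreal (\<phi> (g w)) * indicator A w"
      using fin w by (simp add: sum.delta)
    finally show "ennreal (\<phi> (g w)) * indicator A w
        = (\<Sum>y\<in>g ` space M. ennreal (\<phi> y) * indicator (g -` {y} \<inter> space M \<inter> A) w)" ..
  qed
  also have "\<dots> = (\<Sum>y\<in>g ` space M. ennreal (\<phi> y) * emeasure M (g -` {y} \<inter> space M \<inter> A))"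
    by (simp add: nn_integral_sum nn_integral_cmult_indicator)
  also have "\<dots> = (\<Sum>y\<in>g ` space M. ennreal (measure M (g -` {y} \<inter> space M \<inter> A) * \<phi> y))"
    using assms(4) by (simp add: emeasure_eq_measure ennreal_mult mult.commute)
  also have "\<dots> = ennreal (\<Sum>y\<in>g ` space M. measure M (g -` {y} \<inter> space M \<inter> A) * \<phi> y)"
    using assms(4) by (simp add: sum_ennreal)
  finally show ?thesis .
qed

lemma nn_integral_simple:
  assumes "finite_measure M" "simple_function M g" "\<And>y. \<phi> y \<ge> 0"
  shows "(\<integral>\<^sup>+ w. ennreal (\<phi> (g w)) \<partial>M)
    = ennreal (\<Sum>y\<in>g ` space M. measure M (g -` {y} \<inter> space M) * \<phi> y)"
proof -
  have "(\<integral>\<^sup>+ w. ennreal (\<phi> (g w)) \<partial>M) = (\<integral>\<^sup>+ w \<in> space M. ennreal (\<phi> (g w)) \<partial>M)"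
    by (rule nn_integral_cong) simp
  then show ?thesis
    by (simp only: nn_integral_simple_on[where \<phi>=\<phi>, OF assms(1,2) sets.top assms(3)] Int_assoc Int_absorb)
qed

text \<open>Minkowski's inequality, from convexity with the weights \<open>c i / C\<close>. The
  norms enter through upper bounds, which can be kept positive for the division even where a norm is
  0.\<close>

lemma Lp_norm_sum_le:
  assumes p: "1 \<le> p" and meas: "\<And>i. i < n \<Longrightarrow> a i \<in> borel_measurable M"
    and nonneg: "\<And>i w. a i w \<ge> 0"
    and f: "AE w in M. \<bar>f w\<bar> \<le> (\<Sum>i<n. a i w)"
    and c: "\<And>i. i < n \<Longrightarrow> c i > 0" and a: "\<And>i. i < n \<Longrightarrow> Lp_norm M p (a i) \<le> ennreal (c i)"
  shows "Lp_norm M p f \<le> ennreal (\<Sum>i<(n::nat). c i)"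
proof (cases "n = 0")
  case True
  with f have "Lp_norm M p f = Lp_norm M p (\<lambda>_. 0)"
    by (intro Lp_norm_cong_AE) auto
  then show ?thesis
    using p by (simp add: Lp_norm_def True)
next
  case False
  define C where "C = (\<Sum>i<n. c i)"
  have C: "C > 0"
    unfolding C_def using False c by (intro sum_pos) auto
  have "(\<integral>\<^sup>+ w. ennreal (\<bar>f w\<bar> powr p) \<partial>M)
      \<le> (\<integral>\<^sup>+ w. (\<Sum>i<n. ennreal (c i / C * (C / c i) powr p) * ennreal (\<bar>a i w\<bar> powr p)) \<partial>M)"
  proof (rule nn_integral_mono_AE)
    show "AE w in M. ennreal (\<bar>f w\<bar> powr p)
        \<le> (\<Sum>i<n. ennreal (c i / C * (C / c i) powr p) * ennreal (\<bar>a i w\<bar> powr p))"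
      using f
    proof eventually_elim
      case (elim w)
      have "\<bar>f w\<bar> powr p \<le> (\<Sum>i<n. a i w) powr p"
        using elim p by (intro powr_mono2) auto
      also have "\<dots> \<le> (\<Sum>i<n. c i / C * (a i w / (c i / C)) powr p)"
        using C c nonneg p by (intro powr_sum_weighted_le) (auto simp: C_def sum_divide_distrib[symmetric])
      also have "\<dots> = (\<Sum>i<n. c i / C * (C / c i) powr p * \<bar>a i w\<bar> powr p)"
      proof (rule sum.cong)
        fix i
        show "c i / C * (a i w / (c i / C)) powr p = c i / C * (C / c i) powr p * \<bar>a i w\<bar> powr p"
          using nonneg[of i w] powr_mult[of "C / c i" "a i w" p] by (simp add: mult.commute)
      qed simp
      finally have "ennreal (\<bar>f w\<bar> powr p) \<le> ennreal (\<Sum>i<n. c i / C * (C / c i) powr p * \<bar>a i w\<bar> powr p)"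
        by (rule ennreal_leI)
      also have "\<dots> = (\<Sum>i<n. ennreal (c i / C * (C / c i) powr p * \<bar>a i w\<bar> powr p))"
        using C c by (intro sum_ennreal[symmetric]) (auto simp: less_imp_le)
      also have "\<dots> = (\<Sum>i<n. ennreal (c i / C * (C / c i) powr p) * ennreal (\<bar>a i w\<bar> powr p))"
        using C c by (intro sum.cong refl ennreal_mult) (auto simp: less_imp_le)
      finally show ?case .
    qed
  qed
  also have "\<dots> = (\<Sum>i<n. ennreal (c i / C * (C / c i) powr p) * (\<integral>\<^sup>+ w. ennreal (\<bar>a i w\<bar> powr p) \<partial>M))"
    using meas by (subst nn_integral_sum) (auto simp: nn_integral_cmult)
  also have "\<dots> \<le> (\<Sum>i<n. ennreal (c i / C * (C / c i) powr p) * ennreal (c i powr p))"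
    using a c p by (intro sum_mono mult_left_mono) (auto simp: Lp_norm_le_iff less_imp_le)
  also have "\<dots> = (\<Sum>i<n. ennreal (c i / C * C powr p))"
  proof (rule sum.cong)
    fix i assume i: "i \<in> {..<n}"
    have "(C / c i) powr p * c i powr p = C powr p"
      using c[of i] i by (simp add: powr_mult[symmetric])
    then show "ennreal (c i / C * (C / c i) powr p) * ennreal (c i powr p) = ennreal (c i / C * C powr p)"
      using C c[of i] i by (simp add: ennreal_mult[symmetric] mult.assoc)
  qed simp
  also have "\<dots> = ennreal (\<Sum>i<n. c i / C * C powr p)"
    using C c by (intro sum_ennreal) (auto simp: less_imp_le)
  also have "(\<Sum>i<n. c i / C * C powr p) = C powr p"
    using C by (simp only: sum_distrib_right[symmetric] sum_divide_distrib[symmetric] C_def[symmetric]) simp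
  finally show ?thesis
    using C p by (subst Lp_norm_le_iff) (auto simp: C_def)
qed

subsection \<open>Composition with simple functions\<close>

lemma Phi_integrand:
  assumes "1 < p" "\<sigma> = 1 - 1 / p"
  shows "\<bar>\<bar>a\<bar> powr (1 - \<sigma>) * norm y powr \<sigma>\<bar> powr p = \<bar>a\<bar> * norm y powr (p - 1)"
proof -
  have "\<bar>\<bar>a\<bar> powr (1 - \<sigma>) * norm y powr \<sigma>\<bar> powr p = (\<bar>a\<bar> powr (1 - \<sigma>)) powr p * (norm y powr \<sigma>) powr p"
    by (simp add: powr_mult)
  also have "\<dots> = \<bar>a\<bar> * norm y powr (p - 1)"
    using assms by (simp add: powr_powr left_diff_distrib)
  finally show ?thesis .
qed

text \<open>Pisier's inequality is applied to the values of \<open>g\<close>, weighted by the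
  measures of the level sets. The functionals needed to bound the pointwise sums are the point
  evaluations.\<close>

lemma bochner_norm_comp_simple_le_Phi:
  fixes u :: "('k::topological_space \<Rightarrow>\<^sub>C real) \<Rightarrow> 'e::real_normed_vector"
  assumes M: "finite_measure M" and g: "simple_function M g" and p: "1 < p" "\<sigma> = 1 - 1 / p"
    and D: "D > 0"
      "\<And>(I :: ('k \<Rightarrow>\<^sub>C real) set) m y S.
      \<lbrakk>finite I; \<And>i. i \<in> I \<Longrightarrow> m i \<ge> 0; \<And>t. (\<Sum>i\<in>I. m i * (\<bar>apply_bcontfun (y i) t\<bar> * norm (y i) powr (p - 1))) \<le> S\<rbrakk>
      \<Longrightarrow> (\<Sum>i\<in>I. m i * norm (u (y i)) powr p) \<le> D * S"
  shows "bochner_norm M p (\<lambda>w. u (g w)) \<le> ennreal (D powr (1 / p)) * Phi M p \<sigma> g"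
proof (cases "Phi M p \<sigma> g")
  case (real c)
  let ?m = "\<lambda>y. measure M (g -` {y} \<inter> space M)"
  have p0: "p > 0"
    using p by simp
  have S: "(\<Sum>y\<in>g ` space M. ?m y * (\<bar>apply_bcontfun y t\<bar> * norm y powr (p - 1))) \<le> c powr p" for t
  proof -
    have "Lp_norm M p (\<lambda>w. \<bar>blinfun_apply (point_eval t) (g w)\<bar> powr (1 - \<sigma>) * norm (g w) powr \<sigma>) \<le> Phi M p \<sigma> g"
      unfolding Phi_def by (rule SUP_upper[OF point_eval_in_cball])
    also have "\<dots> = ennreal c"
      using real by simp
    finally have "(\<integral>\<^sup>+ w. ennreal (\<bar>apply_bcontfun (g w) t\<bar> * norm (g w) powr (p - 1)) \<partial>M) \<le> ennreal (c powr p)"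
      by (simp only: Lp_norm_le_iff[OF p0 real(1)] Phi_integrand[OF p] point_eval_apply)
    then show ?thesis
      by (subst (asm) nn_integral_simple[OF M g, of "\<lambda>y. \<bar>apply_bcontfun y t\<bar> * norm y powr (p - 1)"]) auto
  qed
  have "(\<Sum>y\<in>g ` space M. ?m y * norm (u y) powr p) \<le> D * c powr p"
    using g by (intro D(2) S) (auto simp: simple_function_def)
  then have "(\<integral>\<^sup>+ w. ennreal (norm (u (g w)) powr p) \<partial>M) \<le> ennreal (D * c powr p)"
    by (subst nn_integral_simple[OF M g, of "\<lambda>y. norm (u y) powr p"]) (auto intro: ennreal_leI)
  also have "D * c powr p = (D powr (1 / p) * c) powr p"
    using p D(1) real by (simp add: powr_mult powr_powr)
  finally have "bochner_norm M p (\<lambda>w. u (g w)) \<le> ennreal (D powr (1 / p) * c)"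
    unfolding bochner_norm_def using p real by (subst Lp_norm_le_iff) auto
  then show ?thesis
    using real by (simp add: ennreal_mult)
next
  \<comment> \<open>Here \<open>D > 0\<close> matters: for \<open>D = 0\<close> the right-hand side
    would be \<open>0 * \<infinity> = 0\<close>.\<close>
  case top
  then show ?thesis
    using D(1) by (simp add: ennreal_mult_top)
qed

text \<open>The triangle inequality over a decomposition whose cost is still below
  \<open>d\<close>.\<close>

lemma bochner_norm_comp_le_simple_norm:
  fixes u :: "'x::real_normed_vector \<Rightarrow> 'e::real_normed_vector"
  assumes u: "linear u" and p: "1 \<le> p" and "C > 0"
    and Phi: "\<And>g. simple_function M g \<Longrightarrow> bochner_norm M p (\<lambda>w. u (g w)) \<le> ennreal C * Phi M p \<sigma> g"
    and less: "simple_norm M p \<sigma> f < ennreal d"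
  shows "bochner_norm M p (\<lambda>w. u (f w)) \<le> ennreal (C * d)"
proof -
  from less obtain n g where g: "\<And>i. i < n \<Longrightarrow> simple_function M (g i)" "AE w in M. f w = (\<Sum>i<(n::nat). g i w)"
    and sum: "(\<Sum>i<n. Phi M p \<sigma> (g i)) < ennreal d"
    unfolding simple_norm_def Inf_less_iff by blast
  define \<phi> where "\<phi> i = enn2real (Phi M p \<sigma> (g i))" for i
  have \<phi>: "Phi M p \<sigma> (g i) = ennreal (\<phi> i)" "\<phi> i \<ge> 0" if "i < n" for i
  proof -
    have "Phi M p \<sigma> (g i) \<le> (\<Sum>i<n. Phi M p \<sigma> (g i))"
      using that by (intro member_le_sum) auto
    with sum have "Phi M p \<sigma> (g i) < top"
      by (meson ennreal_less_top le_less_trans less_trans)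
    then show "Phi M p \<sigma> (g i) = ennreal (\<phi> i)" "\<phi> i \<ge> 0"
      by (simp_all add: \<phi>_def)
  qed
  have "(\<Sum>i<n. Phi M p \<sigma> (g i)) = ennreal (\<Sum>i<n. \<phi> i)"
    using \<phi> by (subst sum_ennreal[symmetric]) auto
  with sum have "ennreal (\<Sum>i<n. \<phi> i) < ennreal d"
    by simp
  then have d: "(\<Sum>i<n. \<phi> i) < d"
    using \<phi>(2) by (subst (asm) ennreal_less_iff) (auto intro: sum_nonneg)
  \<comment> \<open>The slack is spread over the summands so that each bound is positive; the
    denominator \<open>n + 1\<close> covers the empty decomposition.\<close>
  define \<delta> where "\<delta> = (d - (\<Sum>i<n. \<phi> i)) / (n + 1)"
  have \<delta>: "\<delta> > 0" "(\<Sum>i<n. \<phi> i) + n * \<delta> \<le> d"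
    using d by (auto simp: \<delta>_def field_simps)
  have "bochner_norm M p (\<lambda>w. u (f w)) \<le> ennreal (\<Sum>i<n. C * (\<phi> i + \<delta>))"
    unfolding bochner_norm_def
  proof (rule Lp_norm_sum_le[OF p, where a="\<lambda>i w. norm (u (g i w))"])
    show "(\<lambda>w. norm (u (g i w))) \<in> borel_measurable M" if "i < n" for i
      by (intro borel_measurable_simple_function simple_function_compose1[where g="\<lambda>y. norm (u y)"] g that)
    show "AE w in M. \<bar>norm (u (f w))\<bar> \<le> (\<Sum>i<n. norm (u (g i w)))"
      using g(2) by eventually_elim (simp add: linear_sum[OF u] norm_sum)
    show "C * (\<phi> i + \<delta>) > 0" if "i < n" for i
      using \<phi>(2)[OF that] \<delta>(1) \<open>C > 0\<close> by simp
    show "Lp_norm M p (\<lambda>w. norm (u (g i w))) \<le> ennreal (C * (\<phi> i + \<delta>))" if "i < n" for i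
    proof -
      have "Lp_norm M p (\<lambda>w. norm (u (g i w))) \<le> ennreal (C * \<phi> i)"
        using Phi[OF g(1)[OF that]] \<phi>[OF that] \<open>C > 0\<close> by (simp add: bochner_norm_def ennreal_mult)
      also have "\<dots> \<le> ennreal (C * (\<phi> i + \<delta>))"
        using \<delta>(1) \<open>C > 0\<close> by (intro ennreal_leI) simp
      finally show ?thesis .
    qed
  qed simp
  also have "(\<Sum>i<n. C * (\<phi> i + \<delta>)) = C * ((\<Sum>i<n. \<phi> i) + n * \<delta>)"
    by (simp add: sum_distrib_left[symmetric] sum.distrib)
  also have "ennreal \<dots> \<le> ennreal (C * d)"
    using \<delta>(2) \<open>C > 0\<close> by (intro ennreal_leI mult_left_mono) auto
  finally show ?thesis .
qed

subsection \<open>Lower semicontinuity under Pettis convergence\<close>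

text \<open>Approximation by simple functions provides separability: off a null set the values lie
  in the closure of countably many vectors. This replaces second countability and lets the space be
  cut into countably many pieces on which the function is almost constant.\<close>

lemma strongly_measurable_representative:
  fixes f :: "'w \<Rightarrow> 'x::real_normed_vector"
  assumes "strongly_measurable M f"
  obtains f' and x :: "nat \<Rightarrow> 'x" where "f' \<in> borel_measurable M" "AE w in M. f' w = f w"
    "\<And>w e. w \<in> space M \<Longrightarrow> e > 0 \<Longrightarrow> \<exists>i. norm (f' w - x i) < e"
proof -
  from assms obtain s where s: "\<And>n. simple_function M (s n)" and lim: "AE w in M. (\<lambda>n. s n w) \<longlonglongrightarrow> f w"
    unfolding strongly_measurable_def by blast
  from AE_E3[OF lim] obtain N where N: "\<And>w. w \<in> space M - N \<Longrightarrow> (\<lambda>n. s n w) \<longlonglongrightarrow> f w" "N \<in> null_sets M"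
    by blast
  define t where "t n w = (if w \<in> N then 0 else s n w)" for n w
  define f' where "f' w = (if w \<in> N then 0 else f w)" for w
  have t: "simple_function M (t n)" for n
    unfolding t_def using N(2) by (intro simple_function_If_set s simple_function_const) auto
  have t_lim: "(\<lambda>n. t n w) \<longlonglongrightarrow> f' w" if "w \<in> space M" for w
    using N(1)[of w] that by (simp add: t_def f'_def)
  \<comment> \<open>The element 0 keeps \<open>X\<close> nonempty even over an empty space.\<close>
  define X where "X = insert 0 (\<Union>n. t n ` space M)"
  have "countable (t n ` space M)" for n
    by (rule countable_finite[OF simple_functionD(1)[OF t]])
  then have X: "countable X" "X \<noteq> {}"
    by (auto simp: X_def)
  show ?thesis
  proof (rule that[of f' "from_nat_into X"])
    show "f' \<in> borel_measurable M"
      by (rule borel_measurable_LIMSEQ_metric[OF borel_measurable_simple_function[OF t] t_lim])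
    show "AE w in M. f' w = f w"
      using AE_not_in[OF N(2)] by eventually_elim (simp add: f'_def)
    fix w and e :: real assume w: "w \<in> space M" and "e > 0"
    from LIMSEQ_D[OF t_lim[OF w] this(2)] obtain n where "norm (t n w - f' w) < e"
      by blast
    moreover have "t n w \<in> X"
      using w by (auto simp: X_def)
    then obtain i where "from_nat_into X i = t n w"
      using X from_nat_into_surj by metis
    ultimately show "\<exists>i. norm (f' w - from_nat_into X i) < e"
      by (metis norm_minus_commute)
  qed
qed

text \<open>Pettis convergence is compared with \<open>h\<close> through the mean of \<open>s\<close> over a set on which \<open>h\<close> is
  almost constant. The point evaluations suffice for this as they are norming for \<open>C(K)\<close>.\<close>

lemma mean_value_estimate:
  fixes s h :: "'w \<Rightarrow> 'k::topological_space \<Rightarrow>\<^sub>C real"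
    and u :: "('k \<Rightarrow>\<^sub>C real) \<Rightarrow> 'e::real_normed_vector"
  assumes M: "finite_measure M" and s: "simple_function M s" and h[measurable]: "h \<in> borel_measurable M"
    and A[measurable]: "A \<in> sets M" and \<alpha>: "measure M A > 0" and p: "1 \<le> p" and u: "bounded_linear u"
    and \<epsilon>: "\<epsilon> > 0" and near: "\<And>w. w \<in> A \<Longrightarrow> norm (h w - x) \<le> \<epsilon>"
    and Pettis: "\<And>t. (\<integral>\<^sup>+ w. ennreal (\<bar>apply_bcontfun (s w - h w) t\<bar> powr p) \<partial>M) \<le> ennreal (\<epsilon> powr p * measure M A)"
  shows "ennreal (max 0 (norm (u x) - 3 * \<epsilon> * onorm u) powr p) * emeasure M A
    \<le> (\<integral>\<^sup>+ w \<in> A. ennreal (norm (u (s w)) powr p) \<partial>M)"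
proof -
  interpret finite_measure M by fact
  interpret u: bounded_linear u by fact
  define \<alpha> where "\<alpha> = measure M A"
  define \<beta> where "\<beta> y = measure M (s -` {y} \<inter> space M \<inter> A)" for y
  define Y where "Y = s ` space M"
  have \<alpha>0: "\<alpha> > 0"
    using \<open>measure M A > 0\<close> by (simp add: \<alpha>_def)
  have \<beta>0: "\<beta> y \<ge> 0" for y
    by (simp add: \<beta>_def)
  have Y: "finite Y"
    using s by (simp add: Y_def simple_function_def)
  have int_A: "(\<integral>\<^sup>+ w \<in> A. ennreal (\<phi> (s w)) \<partial>M) = ennreal (\<Sum>y\<in>Y. \<beta> y * \<phi> y)"
    if "\<And>y. \<phi> y \<ge> 0" for \<phi>
    unfolding \<beta>_def Y_def by (rule nn_integral_simple_on[where \<phi>=\<phi>, OF M s A that])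
  have "ennreal \<alpha> = ennreal (\<Sum>y\<in>Y. \<beta> y)"
    using int_A[of "\<lambda>_. 1"] by (simp add: \<alpha>_def emeasure_eq_measure)
  then have sum_\<beta>: "(\<Sum>y\<in>Y. \<beta> y) = \<alpha>"
    using \<alpha>0 \<beta>0 by (subst (asm) ennreal_inj) (auto intro: sum_nonneg)
  define c where "c y = \<beta> y / \<alpha>" for y
  have c: "sum c Y = 1" "c y \<ge> 0" for y
    using \<alpha>0 \<beta>0 sum_\<beta> by (auto simp: c_def sum_divide_distrib[symmetric])
  define v where "v = (\<Sum>y\<in>Y. c y *\<^sub>R y)"
  have "norm (v - x) \<le> 3 * \<epsilon>"
  proof (subst norm_bcontfun_le_iff, rule allI)
    fix t
    have [measurable]: "(\<lambda>w. apply_bcontfun (h w) t) \<in> borel_measurable M"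
      using borel_measurable_continuous_on[OF linear_continuous_on[OF blinfun.bounded_linear_right[of "point_eval t"]] h]
      by simp
    have [measurable]: "(\<lambda>w. apply_bcontfun (s w) t) \<in> borel_measurable M"
      by (intro borel_measurable_simple_function simple_function_compose1[OF s, of "\<lambda>y. apply_bcontfun y t"])
    define \<psi> where "\<psi> w = \<bar>apply_bcontfun (s w - h w) t\<bar>" for w
    have [measurable]: "\<psi> \<in> borel_measurable M"
      unfolding \<psi>_def[abs_def] by simp
    have "ennreal (\<Sum>y\<in>Y. \<beta> y * \<bar>apply_bcontfun (y - x) t\<bar>) = (\<integral>\<^sup>+ w \<in> A. ennreal \<bar>apply_bcontfun (s w - x) t\<bar> \<partial>M)"
      by (rule int_A[symmetric]) simp
    also have "\<dots> \<le> (\<integral>\<^sup>+ w. ennreal (2 * \<epsilon>) * indicator A w + ennreal (\<epsilon> powr (1 - p)) * ennreal (\<psi> w powr p) \<partial>M)"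
    proof (rule nn_integral_mono)
      fix w
      show "ennreal \<bar>apply_bcontfun (s w - x) t\<bar> * indicator A w
          \<le> ennreal (2 * \<epsilon>) * indicator A w + ennreal (\<epsilon> powr (1 - p)) * ennreal (\<psi> w powr p)"
      proof (cases "w \<in> A")
        case True
        \<comment> \<open>A substitute for Hoelder's inequality: where
          \<open>\<psi> w > \<epsilon>\<close>, the factor
          \<open>(\<psi> w / \<epsilon>) powr (p - 1)\<close> is at least 1. One
          \<open>\<epsilon>\<close> arises here, one from \<open>near\<close> and one from
          integrating the last term by \<open>Pettis\<close>, whence the constant 3.\<close>
        have "\<psi> w \<le> \<epsilon> + \<epsilon> powr (1 - p) * \<psi> w powr p"
        proof (cases "\<psi> w \<le> \<epsilon>")
          case False
          then have "\<epsilon> powr (1 - p) * \<psi> w powr p = (\<psi> w / \<epsilon>) powr (p - 1) * \<psi> w"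
            using \<epsilon> by (simp add: powr_divide powr_diff)
          moreover have "1 \<le> (\<psi> w / \<epsilon>) powr (p - 1)"
            using False \<epsilon> p by (intro ge_one_powr_ge_zero) auto
          then have "1 * \<psi> w \<le> (\<psi> w / \<epsilon>) powr (p - 1) * \<psi> w"
            using False \<epsilon> by (intro mult_right_mono) auto
          ultimately show ?thesis
            using \<epsilon> by simp
        qed (auto intro: add_increasing2)
        moreover have "\<bar>apply_bcontfun (s w - x) t\<bar> \<le> \<psi> w + \<epsilon>"
          using near[OF True] abs_apply_bcontfun_le[of "h w - x" t] by (simp add: \<psi>_def)
        ultimately have "\<bar>apply_bcontfun (s w - x) t\<bar> \<le> 2 * \<epsilon> + \<epsilon> powr (1 - p) * \<psi> w powr p"
          by simp
        then have "ennreal \<bar>apply_bcontfun (s w - x) t\<bar> \<le> ennreal (2 * \<epsilon> + \<epsilon> powr (1 - p) * \<psi> w powr p)"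
          by (rule ennreal_leI)
        then show ?thesis
          using True \<epsilon> by (simp add: ennreal_mult ennreal_plus)
      qed simp
    qed
    also have "\<dots> = ennreal (2 * \<epsilon>) * emeasure M A + ennreal (\<epsilon> powr (1 - p)) * (\<integral>\<^sup>+ w. ennreal (\<psi> w powr p) \<partial>M)"
      by (subst nn_integral_add) (auto simp: nn_integral_cmult)
    also have "\<dots> \<le> ennreal (2 * \<epsilon>) * ennreal \<alpha> + ennreal (\<epsilon> powr (1 - p)) * ennreal (\<epsilon> powr p * \<alpha>)"
      using Pettis[of t] by (intro add_mono mult_left_mono) (simp_all add: \<alpha>_def emeasure_eq_measure \<psi>_def)
    also have "\<dots> = ennreal (2 * \<epsilon> * \<alpha> + \<epsilon> powr (1 - p) * (\<epsilon> powr p * \<alpha>))"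
      using \<epsilon> \<alpha>0 by (simp add: ennreal_mult ennreal_plus)
    also have "2 * \<epsilon> * \<alpha> + \<epsilon> powr (1 - p) * (\<epsilon> powr p * \<alpha>) = 3 * \<epsilon> * \<alpha>"
      using \<epsilon> by (simp add: mult.assoc[symmetric] powr_add[symmetric])
    finally have "(\<Sum>y\<in>Y. \<beta> y * \<bar>apply_bcontfun (y - x) t\<bar>) \<le> 3 * \<epsilon> * \<alpha>"
      using \<epsilon> \<alpha>0 by (subst (asm) ennreal_le_iff) auto
    then have "(\<Sum>y\<in>Y. c y * \<bar>apply_bcontfun (y - x) t\<bar>) \<le> 3 * \<epsilon>"
      using \<alpha>0 by (simp add: c_def sum_divide_distrib[symmetric] divide_le_eq)
    moreover have "apply_bcontfun (v - x) t = (\<Sum>y\<in>Y. c y * apply_bcontfun (y - x) t)"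
      using c(1) by (simp add: v_def apply_bcontfun_sum right_diff_distrib sum_subtractf sum_distrib_right[symmetric])
    moreover have "\<bar>\<Sum>y\<in>Y. c y * apply_bcontfun (y - x) t\<bar> \<le> (\<Sum>y\<in>Y. c y * \<bar>apply_bcontfun (y - x) t\<bar>)"
      using c(2) by (intro order.trans[OF sum_abs]) (simp add: abs_mult)
    ultimately show "\<bar>apply_bcontfun (v - x) t\<bar> \<le> 3 * \<epsilon>"
      by simp
  qed
  then have "norm (u (v - x)) \<le> onorm u * (3 * \<epsilon>)"
    using onorm[OF u, of "v - x"] onorm_pos_le[OF u] by (meson mult_left_mono order.trans)
  then have "norm (u x) - 3 * \<epsilon> * onorm u \<le> norm (u v)"
    using norm_triangle_ineq3[of "u v" "u x"] by (simp add: u.diff mult.commute)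
  then have "max 0 (norm (u x) - 3 * \<epsilon> * onorm u) powr p \<le> norm (u v) powr p"
    using p by (intro powr_mono2) auto
  \<comment> \<open>The vector \<open>u v\<close> is the mean of \<open>u (s w)\<close> over
    \<open>A\<close>, so convexity turns the estimate for one vector into one for the
    integral.\<close>
  also have "\<dots> = norm (\<Sum>y\<in>Y. c y *\<^sub>R u y) powr p"
    by (simp add: v_def u.sum u.scaleR)
  also have "\<dots> \<le> (\<Sum>y\<in>Y. c y * norm (u y) powr p)"
    by (intro norm_sum_powr_le p Y c)
  finally have "max 0 (norm (u x) - 3 * \<epsilon> * onorm u) powr p * \<alpha> \<le> (\<Sum>y\<in>Y. \<beta> y * norm (u y) powr p)"
    using \<alpha>0 by (simp add: c_def sum_divide_distrib[symmetric] le_divide_eq)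
  then have "ennreal (max 0 (norm (u x) - 3 * \<epsilon> * onorm u) powr p * \<alpha>)
      \<le> ennreal (\<Sum>y\<in>Y. \<beta> y * norm (u y) powr p)"
    by (rule ennreal_leI)
  also have "\<dots> = (\<integral>\<^sup>+ w \<in> A. ennreal (norm (u (s w)) powr p) \<partial>M)"
    by (rule int_A[symmetric]) simp
  finally show ?thesis
    using \<alpha>0 by (simp add: ennreal_mult \<alpha>_def emeasure_eq_measure)
qed

text \<open>The space is cut into countably many sets on which \<open>f\<close>, up to a null set,
  is within \<open>\<epsilon>\<close> of a fixed vector. On each the mean value estimate holds for
  large \<open>n\<close>; summing gives the bound up to a loss of order \<open>\<epsilon>\<close>,
  which Fatou's lemma removes as \<open>\<epsilon>\<close> tends to 0.\<close>

lemma bochner_norm_comp_Pettis_limit: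
  fixes u :: "('k::topological_space \<Rightarrow>\<^sub>C real) \<Rightarrow> 'e::real_normed_vector"
  assumes M: "finite_measure M" and u: "bounded_linear u" and p: "1 \<le> p" and b: "b \<ge> 0"
    and f: "strongly_measurable M f" and s: "\<And>n. simple_function M (s n)"
    and lim: "(\<lambda>n. pettis_norm M p (\<lambda>w. s n w - f w)) \<longlonglongrightarrow> 0"
    and bound: "\<forall>\<^sub>F n in sequentially. bochner_norm M p (\<lambda>w. u (s n w)) \<le> ennreal b"
  shows "bochner_norm M p (\<lambda>w. u (f w)) \<le> ennreal b"
proof -
  interpret finite_measure M by fact
  interpret u: bounded_linear u by fact
  have p0: "p > 0" using p by simp
  from f obtain h and x :: "nat \<Rightarrow> 'k \<Rightarrow>\<^sub>C real" where h[measurable]: "h \<in> borel_measurable M"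
    and hf: "AE w in M. h w = f w"
    and dense: "\<And>w e. w \<in> space M \<Longrightarrow> e > 0 \<Longrightarrow> \<exists>i. norm (h w - x i) < e"
    using strongly_measurable_representative by blast
  define L where "L = onorm u"
  have L: "L \<ge> 0"
    by (simp add: L_def onorm_pos_le[OF u])
  have [measurable]: "(\<lambda>w. norm (u (h w))) \<in> borel_measurable M"
    by (rule borel_measurable_continuous_on[OF _ h])
      (intro continuous_on_norm linear_continuous_on u)
  have dist_meas: "(\<lambda>w. norm (h w - y)) \<in> borel_measurable M" for y
    by (rule borel_measurable_continuous_on[OF _ h]) (intro continuous_intros)
  \<comment> \<open>Of the loss \<open>4 * \<epsilon> * L\<close>, three parts come from the mean
    value estimate and one from passing between \<open>x i\<close> and \<open>h w\<close>.\<close>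
  define F where "F \<epsilon> w = ennreal (max 0 (norm (u (h w)) - 4 * \<epsilon> * L) powr p)" for \<epsilon> w
  have F_meas[measurable]: "F \<epsilon> \<in> borel_measurable M" for \<epsilon>
    unfolding F_def[abs_def] by simp
  have F_le: "(\<integral>\<^sup>+ w. F \<epsilon> w \<partial>M) \<le> ennreal (b powr p)" if \<epsilon>: "\<epsilon> > 0" for \<epsilon>
  proof -
    define A where "A = disjointed (\<lambda>i. {w \<in> space M. norm (h w - x i) < \<epsilon>})"
    have "range (\<lambda>i. {w \<in> space M. norm (h w - x i) < \<epsilon>}) \<subseteq> sets M"
      using dist_meas by (auto intro!: borel_measurable_less)
    then have A[measurable]: "A i \<in> sets M" for i
      unfolding A_def using sets.range_disjointed_sets by blast
    have disj: "disjoint_family A"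
      unfolding A_def by (rule disjoint_family_disjointed)
    have UA: "(\<Union>i. A i) = space M"
      unfolding A_def UN_disjointed_eq using dense[OF _ \<epsilon>] by auto
    have near: "norm (h w - x i) \<le> \<epsilon>" if "w \<in> A i" for w i
      using that disjointed_subset[of "\<lambda>i. {w \<in> space M. norm (h w - x i) < \<epsilon>}" i]
      by (auto simp: A_def)
    have piece: "\<forall>\<^sub>F n in sequentially. (\<integral>\<^sup>+ w \<in> A i. F \<epsilon> w \<partial>M)
        \<le> (\<integral>\<^sup>+ w \<in> A i. ennreal (norm (u (s n w)) powr p) \<partial>M)" for i
    proof (cases "measure M (A i) = 0")
      case True
      then have "A i \<in> null_sets M"
        by (simp add: null_sets_def emeasure_eq_measure)
      then have "(\<integral>\<^sup>+ w \<in> A i. F \<epsilon> w \<partial>M) = 0"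
        by (simp add: nn_integral_null_set)
      then show ?thesis
        by simp
    next
      case False
      \<comment> \<open>The tolerance of the mean value estimate:
        \<open>\<eta> powr p = \<epsilon> powr p * measure M (A i)\<close>. It is positive because
        null pieces have been set aside.\<close>
      define \<eta> where "\<eta> = \<epsilon> * measure M (A i) powr (1 / p)"
      have A0: "measure M (A i) > 0"
        using False by (simp add: zero_less_measure_iff)
      then have "ennreal \<eta> > 0"
        using \<epsilon> by (simp add: \<eta>_def)
      from order_tendstoD(2)[OF lim this] show ?thesis
      proof eventually_elim
        case (elim n)
        have Pettis: "(\<integral>\<^sup>+ w. ennreal (\<bar>apply_bcontfun (s n w - h w) t\<bar> powr p) \<partial>M)
            \<le> ennreal (\<epsilon> powr p * measure M (A i))" for t
        proof -
          have "Lp_norm M p (\<lambda>w. apply_bcontfun (s n w - h w) t)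
              = Lp_norm M p (\<lambda>w. blinfun_apply (point_eval t) (s n w - f w))"
            using hf by (intro Lp_norm_cong_AE) (auto elim!: eventually_mono)
          also have "\<dots> \<le> pettis_norm M p (\<lambda>w. s n w - f w)"
            unfolding pettis_norm_def by (rule SUP_upper[OF point_eval_in_cball])
          also have "\<dots> \<le> ennreal \<eta>"
            using elim by simp
          finally have "(\<integral>\<^sup>+ w. ennreal (\<bar>apply_bcontfun (s n w - h w) t\<bar> powr p) \<partial>M) \<le> ennreal (\<eta> powr p)"
            using \<epsilon> p by (subst (asm) Lp_norm_le_iff) (auto simp: \<eta>_def)
          also have "\<eta> powr p = \<epsilon> powr p * measure M (A i)"
            using p by (simp add: \<eta>_def powr_mult powr_powr)
          finally show ?thesis .
        qed
        have "(\<integral>\<^sup>+ w \<in> A i. F \<epsilon> w \<partial>M)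
            \<le> (\<integral>\<^sup>+ w. ennreal (max 0 (norm (u (x i)) - 3 * \<epsilon> * L) powr p) * indicator (A i) w \<partial>M)"
        proof (rule nn_integral_mono)
          fix w
          have "max 0 (norm (u (h w)) - 4 * \<epsilon> * L) \<le> max 0 (norm (u (x i)) - 3 * \<epsilon> * L)" if "w \<in> A i"
          proof -
            have "norm (u (h w - x i)) \<le> L * \<epsilon>"
              using onorm[OF u, of "h w - x i"] mult_left_mono[OF near[OF that] L] by (simp add: L_def)
            then show ?thesis
              using norm_triangle_ineq2[of "u (h w)" "u (x i)"]
              by (intro max.mono) (simp_all add: u.diff algebra_simps)
          qed
          then show "F \<epsilon> w * indicator (A i) w
              \<le> ennreal (max 0 (norm (u (x i)) - 3 * \<epsilon> * L) powr p) * indicator (A i) w"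
            using p by (auto simp: F_def indicator_def intro!: ennreal_leI powr_mono2)
        qed
        also have "\<dots> \<le> (\<integral>\<^sup>+ w \<in> A i. ennreal (norm (u (s n w)) powr p) \<partial>M)"
          using mean_value_estimate[OF M s h A A0 p u \<epsilon> near Pettis]
          by (simp add: nn_integral_cmult_indicator L_def)
        finally show ?case .
      qed
    qed
    \<comment> \<open>The threshold for \<open>n\<close> in \<open>piece\<close> depends on
      \<open>i\<close>, so finitely many pieces are treated at a time, with a bound independent of
      \<open>m\<close>.\<close>
    have "(\<Sum>i<m. \<integral>\<^sup>+ w \<in> A i. F \<epsilon> w \<partial>M) \<le> ennreal (b powr p)" for m
    proof -
      have "\<forall>\<^sub>F n in sequentially. \<forall>i\<in>{..<m}. (\<integral>\<^sup>+ w \<in> A i. F \<epsilon> w \<partial>M)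
          \<le> (\<integral>\<^sup>+ w \<in> A i. ennreal (norm (u (s n w)) powr p) \<partial>M)"
        by (intro eventually_ball_finite ballI piece) simp
      from eventually_happens'[OF sequentially_bot eventually_conj[OF this bound]] obtain n where
        n: "\<And>i. i < m \<Longrightarrow> (\<integral>\<^sup>+ w \<in> A i. F \<epsilon> w \<partial>M) \<le> (\<integral>\<^sup>+ w \<in> A i. ennreal (norm (u (s n w)) powr p) \<partial>M)"
          "bochner_norm M p (\<lambda>w. u (s n w)) \<le> ennreal b"
        by blast
      have [measurable]: "(\<lambda>w. norm (u (s n w))) \<in> borel_measurable M"
        by (intro borel_measurable_simple_function simple_function_compose1[OF s, of "\<lambda>y. norm (u y)"])
      have "(\<Sum>i<m. \<integral>\<^sup>+ w \<in> A i. F \<epsilon> w \<partial>M) \<le> (\<Sum>i<m. \<integral>\<^sup>+ w \<in> A i. ennreal (norm (u (s n w)) powr p) \<partial>M)"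
        by (intro sum_mono n) simp
      also have "\<dots> \<le> (\<Sum>i. \<integral>\<^sup>+ w \<in> A i. ennreal (norm (u (s n w)) powr p) \<partial>M)"
        by (rule sum_le_suminf) auto
      also have "\<dots> = (\<integral>\<^sup>+ w \<in> (\<Union>i. A i). ennreal (norm (u (s n w)) powr p) \<partial>M)"
        by (rule nn_integral_disjoint_family[symmetric]) (use disj in auto)
      also have "\<dots> = (\<integral>\<^sup>+ w. ennreal (norm (u (s n w)) powr p) \<partial>M)"
        unfolding UA by (rule nn_integral_cong) simp
      also have "\<dots> \<le> ennreal (b powr p)"
        using n(2) by (simp add: bochner_norm_def Lp_norm_le_iff[OF p0 b])
      finally show ?thesis .
    qed
    then have "(\<Sum>i. \<integral>\<^sup>+ w \<in> A i. F \<epsilon> w \<partial>M) \<le> ennreal (b powr p)"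
      by (intro suminf_le_const) auto
    also have "(\<Sum>i. \<integral>\<^sup>+ w \<in> A i. F \<epsilon> w \<partial>M) = (\<integral>\<^sup>+ w \<in> (\<Union>i. A i). F \<epsilon> w \<partial>M)"
      by (rule nn_integral_disjoint_family[symmetric]) (use disj in auto)
    also have "\<dots> = (\<integral>\<^sup>+ w. F \<epsilon> w \<partial>M)"
      unfolding UA by (rule nn_integral_cong) simp
    finally show ?thesis .
  qed
  have "(\<integral>\<^sup>+ w. ennreal (norm (u (h w)) powr p) \<partial>M) \<le> ennreal (b powr p)"
  proof -
    have "(\<lambda>n. F (inverse (real (Suc n))) w) \<longlonglongrightarrow> ennreal (norm (u (h w)) powr p)" for w
    proof -
      have "(\<lambda>n. F (inverse (real (Suc n))) w) \<longlonglongrightarrow> ennreal (max 0 (norm (u (h w)) - 4 * 0 * L) powr p)"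
        unfolding F_def using p0
        by (intro tendsto_ennrealI tendsto_powr' tendsto_max tendsto_diff tendsto_mult tendsto_const
          LIMSEQ_inverse_real_of_nat) auto
      then show ?thesis by simp
    qed
    then have "(\<integral>\<^sup>+ w. ennreal (norm (u (h w)) powr p) \<partial>M)
        = (\<integral>\<^sup>+ w. liminf (\<lambda>n. F (inverse (real (Suc n))) w) \<partial>M)"
      by (intro nn_integral_cong lim_imp_Liminf[symmetric]) auto
    also have "\<dots> \<le> liminf (\<lambda>n. \<integral>\<^sup>+ w. F (inverse (real (Suc n))) w \<partial>M)"
      by (rule nn_integral_liminf) simp
    also have "\<dots> \<le> ennreal (b powr p)"
      by (intro Liminf_le always_eventually allI F_le) auto
    finally show ?thesis .
  qed
  also have "(\<integral>\<^sup>+ w. ennreal (norm (u (h w)) powr p) \<partial>M) = (\<integral>\<^sup>+ w. ennreal (norm (u (f w)) powr p) \<partial>M)"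
    using hf by (intro nn_integral_cong_AE) (auto elim!: eventually_mono)
  finally show ?thesis
    unfolding bochner_norm_def by (subst Lp_norm_le_iff[OF p0 b]) simp
qed

subsection \<open>Simple functions in the \<open>\<sigma>\<close>-space\<close>

lemma has_bochner_integral_simple_on:
  fixes \<phi> :: "'x \<Rightarrow> real"
  assumes M: "finite_measure M" and g: "simple_function M g" and A: "A \<in> sets M"
  shows "has_bochner_integral M (\<lambda>w. indicator A w * \<phi> (g w))
    (\<Sum>y\<in>g ` space M. measure M (g -` {y} \<inter> space M \<inter> A) * \<phi> y)"
proof -
  interpret finite_measure M by fact
  have sets: "g -` {y} \<inter> space M \<inter> A \<in> sets M" for y
    using simple_functionD(2)[OF g] A by auto
  have fin: "finite (g ` space M)"
    using g by (simp add: simple_function_def)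
  have "has_bochner_integral M (\<lambda>w. \<Sum>y\<in>g ` space M. indicator (g -` {y} \<inter> space M \<inter> A) w * \<phi> y)
      (\<Sum>y\<in>g ` space M. measure M (g -` {y} \<inter> space M \<inter> A) * \<phi> y)"
    using sets
    by (intro has_bochner_integral_sum has_bochner_integral_mult_left has_bochner_integral_real_indicator)
      (auto simp: emeasure_eq_measure)
  moreover have "(\<Sum>y\<in>g ` space M. indicator (g -` {y} \<inter> space M \<inter> A) w * \<phi> y) = indicator A w * \<phi> (g w)"
    if w: "w \<in> space M" for w
  proof -
    have "(\<Sum>y\<in>g ` space M. indicator (g -` {y} \<inter> space M \<inter> A) w * \<phi> y)
        = (\<Sum>y\<in>g ` space M. if y = g w then indicator A w * \<phi> y else 0)"
      by (rule sum.cong) (auto simp: indicator_def w)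
    then show ?thesis
      using fin w by simp
  qed
  ultimately show ?thesis
    by (subst has_bochner_integral_cong[OF refl _ refl]) auto
qed

lemma Lp_norm_simple_finite:
  assumes "finite_measure M" "simple_function M g"
  shows "Lp_norm M p (\<lambda>w. \<phi> (g w)) < \<infinity>"
  using nn_integral_simple[OF assms, of "\<lambda>y. \<bar>\<phi> y\<bar> powr p"] by (simp add: Lp_norm_def)

lemma simple_norm_zero [simp]: "simple_norm M p \<sigma> (\<lambda>w. 0) = 0"
proof -
  have "(\<Sum>i<(0::nat). Phi M p \<sigma> (undefined i)) \<in> {\<Sum>i<n. Phi M p \<sigma> (g i) | (n :: nat) g.
      (\<forall>i<n. simple_function M (g i)) \<and> (AE w in M. 0 = (\<Sum>i<n. g i w))}"
    by (rule CollectI, rule exI[of _ 0], rule exI[of _ undefined]) simp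
  from Inf_lower[OF this] show ?thesis
    unfolding simple_norm_def by (simp add: le_zero_eq)
qed

lemma simple_norm_le_Phi:
  assumes "simple_function M g"
  shows "simple_norm M p \<sigma> g \<le> Phi M p \<sigma> g"
proof -
  have "(\<Sum>i<Suc 0. Phi M p \<sigma> g) \<in> {\<Sum>i<n. Phi M p \<sigma> (h i) | (n :: nat) h.
      (\<forall>i<n. simple_function M (h i)) \<and> (AE w in M. g w = (\<Sum>i<n. h i w))}"
    using assms by (intro CollectI exI[of _ "Suc 0"] exI[of _ "\<lambda>_. g"]) simp
  from Inf_lower[OF this] show ?thesis
    unfolding simple_norm_def by simp
qed

text \<open>The Pettis integral over \<open>A\<close> is the sum of the values weighted by the
  measures of their level sets within \<open>A\<close>.\<close>

lemma pettis_space_simple: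
  fixes g :: "'w \<Rightarrow> 'x::real_normed_vector"
  assumes M: "finite_measure M" and g: "simple_function M g"
  shows "g \<in> pettis_space M p"
proof -
  have bint: "has_bochner_integral (completion M) (\<lambda>w. indicator A w * blinfun_apply x' (g w))
      (blinfun_apply x' (\<Sum>y\<in>g ` space M. measure M (g -` {y} \<inter> space M \<inter> A) *\<^sub>R y))"
    if "A \<in> sets M" for A and x' :: "'x \<Rightarrow>\<^sub>L real"
    using has_bochner_integral_simple_on[OF M g that, of "blinfun_apply x'"]
    by (simp add: has_bochner_integral_iff integrable_completion integral_completion
        borel_measurable_integrable blinfun.sum_right blinfun.scaleR_right)
  have "integrable (completion M) (\<lambda>w. blinfun_apply x' (g w))" for x' :: "'x \<Rightarrow>\<^sub>L real"
  proof -
    have "integrable (completion M) (\<lambda>w. indicator (space M) w * blinfun_apply x' (g w))"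
      using bint[OF sets.top, of x'] by (simp add: has_bochner_integral_iff)
    then show ?thesis
      by (rule Bochner_Integration.integrable_cong[THEN iffD1, rotated -1]) auto
  qed
  moreover have "\<exists>x. \<forall>x' :: 'x \<Rightarrow>\<^sub>L real.
      blinfun_apply x' x = set_lebesgue_integral (completion M) A (\<lambda>w. blinfun_apply x' (g w))"
    if "A \<in> sets M" for A
    unfolding set_lebesgue_integral_def real_scaleR_def has_bochner_integral_integral_eq[OF bint[OF that]]
    by blast
  moreover have "strongly_measurable M g"
    unfolding strongly_measurable_def using g by (intro exI[of _ "\<lambda>_. g"]) simp
  ultimately show ?thesis
    using Lp_norm_simple_finite[OF M g]
    by (auto simp: pettis_space_def pettis_integrable_def)
qed

text \<open>The constant sequence is an admissible approximation. The upper estimate of the norm is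
  what allows continuity to be tested on simple functions with small \<open>Phi\<close>.\<close>

lemma sigma_space_simple:
  fixes g :: "'w \<Rightarrow> 'x::real_normed_vector"
  assumes M: "finite_measure M" and g: "simple_function M g"
  shows "g \<in> sigma_space M p \<sigma>" "sigma_norm M p \<sigma> g \<le> Phi M p \<sigma> g"
proof -
  have "pettis_norm M p (\<lambda>w. g w - g w) = 0"
    by (auto simp: pettis_norm_def Lp_norm_def intro!: antisym SUP_least)
  then have *: "approximating M p \<sigma> g (\<lambda>_. g)"
    using g by (simp add: approximating_def)
  with pettis_space_simple[OF M g] show "g \<in> sigma_space M p \<sigma>"
    unfolding sigma_space_def by blast
  from * have "sigma_norm M p \<sigma> g \<le> simple_norm M p \<sigma> g"
    unfolding sigma_norm_def by (intro Inf_lower CollectI exI[of _ "\<lambda>_. g"]) auto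
  then show "sigma_norm M p \<sigma> g \<le> Phi M p \<sigma> g"
    using simple_norm_le_Phi[OF g] by (rule order.trans)
qed

subsection \<open>Continuity of the composition operator\<close>

lemma strongly_measurable_diff:
  assumes "strongly_measurable M f" "strongly_measurable M g"
  shows "strongly_measurable M (\<lambda>w. f w - g w)"
proof -
  from assms obtain s t where
    s: "\<And>n. simple_function M (s n)" "AE w in M. (\<lambda>n. s n w) \<longlonglongrightarrow> f w" and
    t: "\<And>n. simple_function M (t n)" "AE w in M. (\<lambda>n. t n w) \<longlonglongrightarrow> g w"
    unfolding strongly_measurable_def by blast
  have "AE w in M. (\<lambda>n. s n w - t n w) \<longlonglongrightarrow> f w - g w"
    using s(2) t(2) by eventually_elim (rule tendsto_diff)
  moreover have "simple_function M (\<lambda>w. s n w - t n w)" for n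
    by (rule simple_function_compose2[OF s(1) t(1)])
  ultimately show ?thesis
    unfolding strongly_measurable_def by (intro exI[of _ "\<lambda>n w. s n w - t n w"]) simp
qed

lemma strongly_measurable_comp:
  assumes "bounded_linear u" "strongly_measurable M f"
  shows "strongly_measurable M (u \<circ> f)"
proof -
  from assms(2) obtain s where
    s: "\<And>n. simple_function M (s n)" "AE w in M. (\<lambda>n. s n w) \<longlonglongrightarrow> f w"
    unfolding strongly_measurable_def by blast
  have "AE w in M. (\<lambda>n. u (s n w)) \<longlonglongrightarrow> u (f w)"
    using s(2) by eventually_elim (rule bounded_linear.tendsto[OF assms(1)])
  moreover have "simple_function M (\<lambda>w. u (s n w))" for n
    by (rule simple_function_compose1[OF s(1)])
  ultimately show ?thesis
    unfolding strongly_measurable_def by (intro exI[of _ "\<lambda>n w. u (s n w)"]) simp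
qed

text \<open>For membership, the late terms of an approximating sequence are bounded through
  \<open>s N\<close> and the Cauchy tail. For continuity, the infimum in \<open>sigma_norm\<close>
  supplies a sequence approximating the difference itself. Lower semicontinuity then passes to the
  limit in both cases.\<close>

lemma comp_continuous_if_Phi_bound:
  fixes M :: "'w measure" and u :: "('k::topological_space \<Rightarrow>\<^sub>C real) \<Rightarrow> 'e::real_normed_vector"
  assumes M: "finite_measure M" and u: "bounded_linear u" and p: "1 \<le> p" and C: "C > 0"
    and Phi: "\<And>g. simple_function M g \<Longrightarrow> bochner_norm M p (\<lambda>w. u (g w)) \<le> ennreal C * Phi M p \<sigma> g"
  shows "\<forall>f \<in> sigma_space M p \<sigma>. u \<circ> f \<in> bochner_space M p"
    and "seminorm_continuous_on (sigma_space M p \<sigma>) (sigma_norm M p \<sigma>) (bochner_norm M p) (\<lambda>f. u \<circ> f)"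
proof -
  interpret u: bounded_linear u by fact
  note bound = bochner_norm_comp_le_simple_norm[OF u.linear p C Phi]
  show "\<forall>f \<in> sigma_space M p \<sigma>. u \<circ> f \<in> bochner_space M p"
  proof
    fix f :: "'w \<Rightarrow> 'k \<Rightarrow>\<^sub>C real" assume "f \<in> sigma_space M p \<sigma>"
    then obtain s where f: "strongly_measurable M f" and s: "approximating M p \<sigma> f s"
      by (auto simp: sigma_space_def pettis_space_def)
    then have simple: "simple_function M (s n)" for n
      by (simp add: approximating_def)
    have "\<exists>N. \<forall>m\<ge>N. \<forall>n\<ge>N. simple_norm M p \<sigma> (\<lambda>w. s m w - s n w) < ennreal 1"
      using s unfolding approximating_def by (metis zero_less_one)
    then obtain N where N: "\<And>n. n \<ge> N \<Longrightarrow> simple_norm M p \<sigma> (\<lambda>w. s n w - s N w) < ennreal 1"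
      by blast
    have "bochner_norm M p (\<lambda>w. u (s N w)) < \<infinity>"
      unfolding bochner_norm_def by (rule Lp_norm_simple_finite[OF M simple])
    then obtain b where b: "b \<ge> 0" "bochner_norm M p (\<lambda>w. u (s N w)) = ennreal b"
      by (cases "bochner_norm M p (\<lambda>w. u (s N w))") auto
    have "bochner_norm M p (\<lambda>w. u (s n w)) \<le> ennreal (b + 1 + C)" if "n \<ge> N" for n
    proof -
      \<comment> \<open>Two-term Minkowski; \<open>b + 1\<close> replaces \<open>b\<close>, which
        may be 0, since the bounds have to be positive.\<close>
      have "Lp_norm M p (\<lambda>w. norm (u (s n w))) \<le> ennreal (\<Sum>i<2::nat. if i = 0 then b + 1 else C)"
      proof (rule Lp_norm_sum_le[OF p, where a="\<lambda>i w. if i = 0 then norm (u (s N w)) else norm (u (s n w - s N w))"])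
        fix i :: nat
        have "(\<lambda>w. norm (u (s N w))) \<in> borel_measurable M"
          by (intro borel_measurable_simple_function simple_function_compose1[OF simple, of "\<lambda>y. norm (u y)"])
        moreover have "(\<lambda>w. norm (u (s n w - s N w))) \<in> borel_measurable M"
          by (intro borel_measurable_simple_function
              simple_function_compose2[OF simple simple, of "\<lambda>y z. norm (u (y - z))"])
        ultimately show "(\<lambda>w. if i = 0 then norm (u (s N w)) else norm (u (s n w - s N w))) \<in> borel_measurable M"
          by simp
        have "bochner_norm M p (\<lambda>w. u (s n w - s N w)) \<le> ennreal (C * 1)"
          by (rule bound[OF _ N[OF that]])
        moreover have "ennreal b \<le> ennreal (b + 1)"
          by (rule ennreal_leI) simp
        ultimately show "Lp_norm M p (\<lambda>w. if i = 0 then norm (u (s N w)) else norm (u (s n w - s N w)))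
            \<le> ennreal (if i = 0 then b + 1 else C)"
          using b(2) by (simp add: bochner_norm_def)
        show "0 < (if i = 0 then b + 1 else C)"
          using b(1) C by simp
      next
        have "norm (u (s n w)) \<le> norm (u (s N w)) + norm (u (s n w - s N w))" for w
          using norm_triangle_ineq2[of "u (s n w)" "u (s N w)"] by (simp add: u.diff)
        then show "AE w in M. \<bar>norm (u (s n w))\<bar>
            \<le> (\<Sum>i<2::nat. if i = 0 then norm (u (s N w)) else norm (u (s n w - s N w)))"
          by (intro AE_I2) (simp add: numeral_2_eq_2)
      qed simp
      then show ?thesis
        by (simp add: bochner_norm_def numeral_2_eq_2)
    qed
    then have "\<forall>\<^sub>F n in sequentially. bochner_norm M p (\<lambda>w. u (s n w)) \<le> ennreal (b + 1 + C)"
      by (auto simp: eventually_sequentially)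
    with s b(1) C have "bochner_norm M p (\<lambda>w. u (f w)) \<le> ennreal (b + 1 + C)"
      by (intro bochner_norm_comp_Pettis_limit[OF M u p _ f simple]) (auto simp: approximating_def)
    also have "\<dots> < \<infinity>"
      by simp
    finally show "u \<circ> f \<in> bochner_space M p"
      using strongly_measurable_comp[OF u f] by (simp add: bochner_space_def comp_def)
  qed
  show "seminorm_continuous_on (sigma_space M p \<sigma>) (sigma_norm M p \<sigma>) (bochner_norm M p) (\<lambda>f. u \<circ> f)"
    unfolding seminorm_continuous_on_def
  proof (intro ballI allI impI)
    fix f :: "'w \<Rightarrow> 'k \<Rightarrow>\<^sub>C real" and e :: real assume f: "f \<in> sigma_space M p \<sigma>" and "e > 0"
    \<comment> \<open>The factor 2 turns the non-strict bound \<open>C * d\<close> into the strict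
      one required.\<close>
    define d where "d = e / (2 * C)"
    have d: "d > 0" "C * d < e"
      using \<open>e > 0\<close> C by (auto simp: d_def)
    have "bochner_norm M p (\<lambda>w. (u \<circ> g) w - (u \<circ> f) w) < ennreal e"
      if g: "g \<in> sigma_space M p \<sigma>" and less: "sigma_norm M p \<sigma> (\<lambda>w. g w - f w) < ennreal d" for g
    proof -
      from less obtain l s where s: "approximating M p \<sigma> (\<lambda>w. g w - f w) s"
        and l: "(\<lambda>n. simple_norm M p \<sigma> (s n)) \<longlonglongrightarrow> l" "l < ennreal d"
        unfolding sigma_norm_def Inf_less_iff by blast
      have meas: "strongly_measurable M (\<lambda>w. g w - f w)"
        using f g by (intro strongly_measurable_diff) (auto simp: sigma_space_def pettis_space_def)
      have "\<forall>\<^sub>F n in sequentially. bochner_norm M p (\<lambda>w. u (s n w)) \<le> ennreal (C * d)"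
        using order_tendstoD(2)[OF l] by eventually_elim (rule bound)
      with s C d(1) have "bochner_norm M p (\<lambda>w. u (g w - f w)) \<le> ennreal (C * d)"
        by (intro bochner_norm_comp_Pettis_limit[OF M u p _ meas, of "C * d" s])
          (auto simp: approximating_def)
      also have "\<dots> < ennreal e"
        using d(2) \<open>e > 0\<close> by (simp add: ennreal_less_iff C d(1) less_imp_le)
      finally show ?thesis
        by (simp add: u.diff)
    qed
    with d(1) show "\<exists>d>0. \<forall>g\<in>sigma_space M p \<sigma>. sigma_norm M p \<sigma> (\<lambda>w. g w - f w) < ennreal d \<longrightarrow>
        bochner_norm M p (\<lambda>w. (u \<circ> g) w - (u \<circ> f) w) < ennreal e"
      by blast
  qed
qed

subsection \<open>Necessity of Pisier's inequality\<close>

text \<open>Splitting off \<open>B'\<close> leaves a remainder of positive measure, in which the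
  induction continues. The sizes stay uncontrolled and are compensated later by scaling the vectors
  placed on the sets.\<close>

lemma nonatomic_disjoint_sets:
  assumes M: "finite_measure M" and na: "nonatomic M" and "B \<in> sets M" "emeasure M B > 0"
  shows "\<exists>A. (\<forall>i<n. A i \<in> sets M \<and> A i \<subseteq> B \<and> emeasure M (A i) > 0) \<and> disjoint_family_on A {..<n::nat}"
  using assms(3,4)
proof (induction n arbitrary: B)
  case 0
  then show ?case
    by (simp add: disjoint_family_on_def)
next
  case (Suc n)
  interpret finite_measure M by fact
  from na Suc.prems obtain B' where B': "B' \<in> sets M" "B' \<subseteq> B" "0 < emeasure M B'" "emeasure M B' < emeasure M B"
    unfolding nonatomic_def by blast
  have "emeasure M (B - B') = emeasure M B - emeasure M B'"
    using B' Suc.prems by (intro emeasure_Diff) auto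
  with B' have pos: "emeasure M (B - B') > 0"
    by (simp add: diff_gr0_ennreal)
  have "B - B' \<in> sets M"
    using B' Suc.prems by auto
  from Suc.IH[OF this pos] obtain A where
    A: "\<And>i. i < n \<Longrightarrow> A i \<in> sets M \<and> A i \<subseteq> B - B' \<and> emeasure M (A i) > 0" "disjoint_family_on A {..<n}"
    by blast
  define A' where "A' i = (if i < n then A i else B')" for i
  have "A' i \<inter> A' j = {}" if "i < Suc n" "j < Suc n" "i \<noteq> j" for i j
  proof (cases "i < n \<and> j < n")
    case True
    then show ?thesis
      using A(2) that by (auto simp: A'_def disjoint_family_on_def)
  next
    case False
    then show ?thesis
      using A(1)[of i] A(1)[of j] that by (auto simp: A'_def)
  qed
  moreover have "A' i \<in> sets M \<and> A' i \<subseteq> B \<and> emeasure M (A' i) > 0" for i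
    using A(1)[of i] B' by (auto simp: A'_def)
  ultimately show ?case
    unfolding disjoint_family_on_def by (intro exI[of _ A']) auto
qed

lemma nn_integral_disjoint_simple:
  fixes z :: "nat \<Rightarrow> 'x::real_vector"
  assumes M: "finite_measure M" and A: "\<And>i. i < n \<Longrightarrow> A i \<in> sets M" "disjoint_family_on A {..<n}"
    and \<phi>: "\<phi> 0 = 0" "\<And>y. \<phi> y \<ge> 0"
  shows "(\<integral>\<^sup>+ w. ennreal (\<phi> (\<Sum>i<n. indicator (A i) w *\<^sub>R z i)) \<partial>M) = ennreal (\<Sum>i<n. measure M (A i) * \<phi> (z i))"
proof -
  interpret finite_measure M by fact
  have "ennreal (\<phi> (\<Sum>i<n. indicator (A i) w *\<^sub>R z i)) = (\<Sum>i<n. ennreal (\<phi> (z i)) * indicator (A i) w)" for w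
  proof (cases "\<exists>j<n. w \<in> A j")
    case True
    then obtain j where j: "j < n" "w \<in> A j" by blast
    have ind: "indicator (A i) w = (if i = j then 1 else 0 :: 'b::zero_neq_one)" if "i < n" for i
      using A(2) j that by (auto simp: disjoint_family_on_def indicator_def)
    have "(\<Sum>i<n. indicator (A i) w *\<^sub>R z i) = (\<Sum>i<n. if i = j then z i else 0)"
      by (rule sum.cong) (auto simp: ind)
    moreover have "(\<Sum>i<n. ennreal (\<phi> (z i)) * indicator (A i) w) = (\<Sum>i<n. if i = j then ennreal (\<phi> (z i)) else 0)"
      by (rule sum.cong) (auto simp: ind)
    ultimately show ?thesis
      using j by simp
  next
    \<comment> \<open>Outside all \<open>A i\<close> the sum is 0, which is where
      \<open>\<phi> 0 = 0\<close> enters.\<close>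
    case False
    then show ?thesis
      using \<phi>(1) by (simp add: indicator_def)
  qed
  then have "(\<integral>\<^sup>+ w. ennreal (\<phi> (\<Sum>i<n. indicator (A i) w *\<^sub>R z i)) \<partial>M)
      = (\<integral>\<^sup>+ w. (\<Sum>i<n. ennreal (\<phi> (z i)) * indicator (A i) w) \<partial>M)"
    by (simp only:)
  also have "\<dots> = (\<Sum>i<n. ennreal (\<phi> (z i)) * emeasure M (A i))"
    using A(1) by (subst nn_integral_sum) (auto simp: nn_integral_cmult_indicator)
  also have "\<dots> = (\<Sum>i<n. ennreal (measure M (A i) * \<phi> (z i)))"
    using \<phi>(2) by (simp add: emeasure_eq_measure ennreal_mult mult.commute)
  also have "\<dots> = ennreal (\<Sum>i<n. measure M (A i) * \<phi> (z i))"
    using \<phi>(2) by (intro sum_ennreal) simp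
  finally show ?thesis .
qed

text \<open>The bound is tested on a function equal to a multiple of \<open>x i\<close> on
  \<open>A i\<close>. For functionals in the dual ball, choosing signs reduces the estimate of
  \<open>Phi\<close> to the pointwise sums on K.\<close>

lemma pisier_if_comp_bounded:
  fixes u :: "('k::topological_space \<Rightarrow>\<^sub>C real) \<Rightarrow> 'e::real_normed_vector"
  assumes M: "finite_measure M" "emeasure M (space M) > 0" "nonatomic M" and u: "linear u"
    and p: "1 < p" "\<sigma> = 1 - 1 / p" and d: "d > 0"
    and bound: "\<And>g. simple_function M g \<Longrightarrow> Phi M p \<sigma> g \<le> ennreal d \<Longrightarrow> bochner_norm M p (\<lambda>w. u (g w)) \<le> 1"
    and r: "r > 0" "\<And>i. i < (n::nat) \<Longrightarrow> norm (x i) \<le> r" "\<And>t. (\<Sum>i<n. \<bar>apply_bcontfun (x i) t\<bar>) \<le> S"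
  shows "(\<Sum>i<n. norm (u (x i)) powr p) \<le> (1 / d) powr p * r powr (p - 1) * S"
proof (rule field_le_epsilon)
  fix e :: real assume "e > 0"
  interpret finite_measure M by fact
  have p0: "p > 0" using p by simp
  have "0 \<le> S"
    by (rule order.trans[OF sum_nonneg r(3)]) simp
  define T where "T = r powr (p - 1) * S + e * d powr p"
  have T: "T > 0" "r powr (p - 1) * S \<le> T"
    using r(1) \<open>0 \<le> S\<close> \<open>e > 0\<close> d by (auto simp: T_def add_nonneg_pos)
  obtain A where A: "\<And>i. i < n \<Longrightarrow> A i \<in> sets M" "\<And>i. i < n \<Longrightarrow> emeasure M (A i) > 0" "disjoint_family_on A {..<n}"
    using nonatomic_disjoint_sets[OF M(1,3) sets.top M(2), of n] by blast
  have \<mu>: "measure M (A i) > 0" if "i < n" for i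
    using A(2)[OF that] by (simp add: emeasure_eq_measure)
  \<comment> \<open>Makes \<open>measure M (A i) * c i powr p\<close> equal to
    \<open>d powr p / T\<close> for all \<open>i\<close>: the unequal measures cancel, and
    \<open>Phi M p \<sigma> g\<close> is at most \<open>d\<close>.\<close>
  define c where "c i = d * T powr (- 1 / p) * measure M (A i) powr (- 1 / p)" for i
  define z where "z i = c i *\<^sub>R x i" for i
  define g where "g w = (\<Sum>i<n. indicator (A i) w *\<^sub>R z i)" for w
  have c: "c i \<ge> 0" "measure M (A i) * c i powr p = d powr p / T" if "i < n" for i
  proof -
    have root: "(y powr (- 1 / p)) powr p = 1 / y" if "y > 0" for y :: real
      unfolding powr_powr using that p0 by (simp add: powr_minus_divide)
    show "c i \<ge> 0"
      using d by (simp add: c_def)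
    show "measure M (A i) * c i powr p = d powr p / T"
      unfolding c_def powr_mult root[OF T(1)] root[OF \<mu>[OF that]] using \<mu>[OF that] by simp
  qed
  have g: "simple_function M g"
    unfolding g_def[abs_def]
    by (intro simple_function_sum simple_function_compose1[OF simple_function_indicator[OF A(1)], of _ "\<lambda>c. c *\<^sub>R z _"]) auto
  have "Phi M p \<sigma> g \<le> ennreal d"
    unfolding Phi_def
  proof (rule SUP_least)
    fix x' :: "('k \<Rightarrow>\<^sub>C real) \<Rightarrow>\<^sub>L real" assume x': "x' \<in> cball 0 1"
    have "(\<integral>\<^sup>+ w. ennreal (\<bar>blinfun_apply x' (g w)\<bar> * norm (g w) powr (p - 1)) \<partial>M)
        = ennreal (\<Sum>i<n. measure M (A i) * (\<bar>blinfun_apply x' (z i)\<bar> * norm (z i) powr (p - 1)))"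
      unfolding g_def
      by (rule nn_integral_disjoint_simple[where \<phi>="\<lambda>y. \<bar>blinfun_apply x' y\<bar> * norm y powr (p - 1)", OF M(1) A(1,3)])
        auto
    also have "\<dots> \<le> ennreal (d powr p)"
    proof (rule ennreal_leI)
      have "(\<Sum>i<n. measure M (A i) * (\<bar>blinfun_apply x' (z i)\<bar> * norm (z i) powr (p - 1)))
          = (\<Sum>i<n. d powr p / T * (\<bar>blinfun_apply x' (x i)\<bar> * norm (x i) powr (p - 1)))"
      proof (rule sum.cong)
        fix i assume "i \<in> {..<n}"
        then have i: "i < n" by simp
        have "c i * c i powr (p - 1) = c i powr p"
          using c(1)[OF i] by (cases "c i = 0") (auto simp: powr_diff)
        then have "\<bar>blinfun_apply x' (z i)\<bar> * norm (z i) powr (p - 1)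
            = c i powr p * (\<bar>blinfun_apply x' (x i)\<bar> * norm (x i) powr (p - 1))"
          using c(1)[OF i] by (simp add: z_def blinfun.scaleR_right abs_mult powr_mult)
        then show "measure M (A i) * (\<bar>blinfun_apply x' (z i)\<bar> * norm (z i) powr (p - 1))
            = d powr p / T * (\<bar>blinfun_apply x' (x i)\<bar> * norm (x i) powr (p - 1))"
          using c(2)[OF i] by (metis mult.assoc)
      qed simp
      also have "\<dots> \<le> (\<Sum>i<n. d powr p / T * (\<bar>blinfun_apply x' (x i)\<bar> * r powr (p - 1)))"
        using r(2) p T(1) by (intro sum_mono mult_left_mono powr_mono2) auto
      also have "\<dots> = d powr p / T * (r powr (p - 1) * (\<Sum>i<n. \<bar>blinfun_apply x' (x i)\<bar>))"
        by (simp add: sum_distrib_left mult.commute)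
      also have "\<dots> \<le> d powr p / T * (r powr (p - 1) * S)"
        using sum_abs_dual_le[OF x' r(3)] T(1) by (intro mult_left_mono) auto
      also have "\<dots> \<le> d powr p / T * T"
        using T by (intro mult_left_mono) auto
      also have "\<dots> = d powr p"
        using T by simp
      finally show "(\<Sum>i<n. measure M (A i) * (\<bar>blinfun_apply x' (z i)\<bar> * norm (z i) powr (p - 1))) \<le> d powr p" .
    qed
    finally show "Lp_norm M p (\<lambda>w. \<bar>blinfun_apply x' (g w)\<bar> powr (1 - \<sigma>) * norm (g w) powr \<sigma>) \<le> ennreal d"
      by (simp only: Lp_norm_le_iff[OF p0 less_imp_le[OF d]] Phi_integrand[OF p])
  qed
  from bound[OF g this] have "Lp_norm M p (\<lambda>w. norm (u (g w))) \<le> ennreal 1"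
    by (simp add: bochner_norm_def)
  then have "(\<integral>\<^sup>+ w. ennreal (norm (u (g w)) powr p) \<partial>M) \<le> ennreal 1"
    by (simp add: Lp_norm_le_iff[OF p0, of 1, simplified])
  also have "(\<integral>\<^sup>+ w. ennreal (norm (u (g w)) powr p) \<partial>M)
      = ennreal (\<Sum>i<n. measure M (A i) * norm (u (z i)) powr p)"
    unfolding g_def
    by (rule nn_integral_disjoint_simple[where \<phi>="\<lambda>y. norm (u y) powr p", OF M(1) A(1,3)])
      (auto simp: linear_0[OF u])
  also have "(\<Sum>i<n. measure M (A i) * norm (u (z i)) powr p) = (\<Sum>i<n. d powr p / T * norm (u (x i)) powr p)"
  proof (rule sum.cong)
    fix i assume "i \<in> {..<n}"
    then have i: "i < n" by simp
    have "norm (u (z i)) powr p = c i powr p * norm (u (x i)) powr p"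
      using c(1)[OF i] by (simp add: z_def linear_scale[OF u] powr_mult)
    then show "measure M (A i) * norm (u (z i)) powr p = d powr p / T * norm (u (x i)) powr p"
      using c(2)[OF i] by (metis mult.assoc)
  qed simp
  also have "\<dots> = d powr p * (\<Sum>i<n. norm (u (x i)) powr p) / T"
    by (simp add: sum_distrib_left sum_divide_distrib)
  finally have "d powr p * (\<Sum>i<n. norm (u (x i)) powr p) \<le> T"
    using T(1) by (simp add: divide_le_eq)
  then have "(\<Sum>i<n. norm (u (x i)) powr p) \<le> T / d powr p"
    using d by (simp add: le_divide_eq mult.commute)
  also have "\<dots> = (1 / d) powr p * r powr (p - 1) * S + e"
    using d by (simp add: T_def powr_divide field_simps)
  finally show "(\<Sum>i<n. norm (u (x i)) powr p) \<le> (1 / d) powr p * r powr (p - 1) * S + e" .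
qed

theorem corollary13:
  fixes M :: "'w measure"
    and u :: "('k::t2_space \<Rightarrow>\<^sub>C real) \<Rightarrow> 'e::banach"
    and p q p' \<sigma> :: real
  assumes "finite_measure M" and "emeasure M (space M) > 0" and "nonatomic M"
    and "compact (UNIV :: 'k set)"
    and "1 \<le> q" and "q < p" and "1 / p + 1 / p' = 1" and "\<sigma> = 1 / p'"
    and "bounded_linear u"
  shows "pq_summing p q u \<longleftrightarrow>
    (\<forall>f \<in> sigma_space M p \<sigma>. u \<circ> f \<in> bochner_space M p) \<and>
    seminorm_continuous_on (sigma_space M p \<sigma>) (sigma_norm M p \<sigma>) (bochner_norm M p)
      (\<lambda>f. u \<circ> f)"
proof
  interpret u: bounded_linear u by fact
  have p: "1 < p" and \<sigma>: "\<sigma> = 1 - 1 / p"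
    using assms(5-8) by auto
  {
    assume summing: "pq_summing p q u"
    show "(\<forall>f \<in> sigma_space M p \<sigma>. u \<circ> f \<in> bochner_space M p) \<and>
        seminorm_continuous_on (sigma_space M p \<sigma>) (sigma_norm M p \<sigma>) (bochner_norm M p) (\<lambda>f. u \<circ> f)"
    proof (rule pisier_inequality[OF assms(4) summing assms(5,6)])
      fix D assume D: "D \<ge> 0"
        "\<And>(I :: ('k \<Rightarrow>\<^sub>C real) set) m (y :: ('k \<Rightarrow>\<^sub>C real) \<Rightarrow> 'k \<Rightarrow>\<^sub>C real) S.
          \<lbrakk>finite I; \<And>i. i \<in> I \<Longrightarrow> m i \<ge> 0; \<And>t. (\<Sum>i\<in>I. m i * (\<bar>apply_bcontfun (y i) t\<bar> * norm (y i) powr (p - 1))) \<le> S\<rbrakk>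
          \<Longrightarrow> (\<Sum>i\<in>I. m i * norm (u (y i)) powr p) \<le> D * S"
      \<comment> \<open>\<open>D\<close> may be 0 while a positive constant is required below;
        \<open>D + 1\<close> serves because \<open>S \<ge> 0\<close>.\<close>
      have "bochner_norm M p (\<lambda>w. u (g w)) \<le> ennreal ((D + 1) powr (1 / p)) * Phi M p \<sigma> g"
        if "simple_function M g" for g
      proof (rule bochner_norm_comp_simple_le_Phi[OF assms(1) that p \<sigma>])
        fix I :: "('k \<Rightarrow>\<^sub>C real) set" and m and y :: "('k \<Rightarrow>\<^sub>C real) \<Rightarrow> 'k \<Rightarrow>\<^sub>C real" and S
        assume *: "finite I" "\<And>i. i \<in> I \<Longrightarrow> m i \<ge> 0"
          "\<And>t. (\<Sum>i\<in>I. m i * (\<bar>apply_bcontfun (y i) t\<bar> * norm (y i) powr (p - 1))) \<le> S"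
        have "0 \<le> S"
          using *(2) by (intro order.trans[OF sum_nonneg *(3)]) auto
        with D(2)[OF *] show "(\<Sum>i\<in>I. m i * norm (u (y i)) powr p) \<le> (D + 1) * S"
          by (simp add: distrib_right)
      qed (use D(1) in simp)
      then show ?thesis
        using D(1) p by (intro conjI comp_continuous_if_Phi_bound[OF assms(1,9)]) auto
    qed
  next
    assume "(\<forall>f \<in> sigma_space M p \<sigma>. u \<circ> f \<in> bochner_space M p) \<and>
      seminorm_continuous_on (sigma_space M p \<sigma>) (sigma_norm M p \<sigma>) (bochner_norm M p) (\<lambda>f. u \<circ> f)"
    then have cont: "seminorm_continuous_on (sigma_space M p \<sigma>) (sigma_norm M p \<sigma>) (bochner_norm M p) (\<lambda>f. u \<circ> f)"
      by simp
    \<comment> \<open>Continuity at the zero function, with tolerance 1, already bounds the operator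
      on simple functions.\<close>
    have zero: "(\<lambda>_. 0) \<in> sigma_space M p \<sigma>"
      by (rule sigma_space_simple(1)[OF assms(1)]) simp
    obtain d where d: "d > 0" and "\<forall>g\<in>sigma_space M p \<sigma>. sigma_norm M p \<sigma> (\<lambda>w. g w - 0) < ennreal d \<longrightarrow>
        bochner_norm M p (\<lambda>w. (u \<circ> g) w - (u \<circ> (\<lambda>_. 0)) w) < ennreal 1"
      using cont[unfolded seminorm_continuous_on_def, THEN bspec, OF zero, THEN spec, of 1] by auto
    then have less: "bochner_norm M p (\<lambda>w. u (g w)) < 1"
      if "g \<in> sigma_space M p \<sigma>" "sigma_norm M p \<sigma> g < ennreal d" for g
      using that by (simp add: u.zero comp_def)
    \<comment> \<open>Halving \<open>d\<close> reconciles the non-strict bound on \<open>Phi\<close>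
      with the strict inequality in the definition of continuity.\<close>
    have "bochner_norm M p (\<lambda>w. u (g w)) \<le> 1"
      if "simple_function M g" "Phi M p \<sigma> g \<le> ennreal (d / 2)" for g
    proof -
      have "sigma_norm M p \<sigma> g \<le> ennreal (d / 2)"
        using sigma_space_simple(2)[OF assms(1) that(1)] that(2) by (rule order.trans)
      also have "\<dots> < ennreal d"
        using d by (simp add: ennreal_less_iff)
      finally show ?thesis
        using less[OF sigma_space_simple(1)[OF assms(1) that(1)]] by simp
    qed
    from pisier_if_comp_bounded[OF assms(1-3) u.linear p \<sigma> half_gt_zero[OF d] this]
    show "pq_summing p q u"
      by (intro pq_summing_if_pisier[OF assms(4,9,5,6), of "(1 / (d / 2)) powr p"]) auto
  }
qed

end
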